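(* Let $\lambda=\Phi(\mu,\nu,k)$ with $k\ge0$ be a partition with 2-quotient $(\mu,\nu)$ and 2-core $\bar\lambda=(k,\dots,1)$, and write $R_\lambda(x)=\sum_{j=0}^{|\mu|+|\nu|}r_{\lambda,j}x^{|\mu|+|\nu|-j}$. Then for $j=0,1,\dots,|\mu|+|\nu|$, $$r_{\lambda,j}=(-1)^j\binom{|\mu|+|\nu|}{j}\sum_{(\tilde\mu,\tilde\nu)<_j(\mu,\nu)}(-1)^{\mathrm{ht}_2(\lambda/\tilde\lambda)}\frac{F^{(2)}_{(\tilde\mu,\tilde\nu)}\,F^{(2)}_{(\mu,\nu)/(\tilde\mu,\tilde\nu)}}{F^{(2)}_{(\mu,\nu)}}\,\frac{H_{\mathrm{odd}}(\lambda)}{H_{\mathrm{odd}}(\tilde\lambda)},$$ where $\tilde\lambda=\Phi(\tilde\mu,\tilde\nu,k)$ is the partition with quotient $(\tilde\mu,\tilde\nu)$ and the same core as $\lambda$.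
   Context: Partitions $\lambda=(\lambda_1\ge\dots\ge\lambda_{\ell(\lambda)}>0)$, $|\lambda|=\sum\lambda_i$, degree vector $n_i=\lambda_i+\ell(\lambda)-i$, $\Delta(n_\lambda)=\prod_{i<j}(n_j-n_i)$. Hermite: $\mathrm{He}_0=1,\mathrm{He}_1=x,\mathrm{He}_n=x\mathrm{He}_{n-1}-(n-1)\mathrm{He}_{n-2}$; $\mathrm{He}_\lambda=\mathrm{Wr}[\mathrm{He}_{n_1},\dots,\mathrm{He}_{n_{\ell(\lambda)}}]/\Delta(n_\lambda)$. Maya diagram: a set $M\subset\mathbb{Z}$ containing all sufficiently negative integers and finitely many non-negative ones; $\lambda(M)$ has parts the positive values of $\#\{n\notin M:n<m\}$, $m\in M$. $M_\lambda=\{n<0\}\cup\{n_i\}$, $M_\lambda+t=\{m+t:m\in M_\lambda\}$. For partitions $\mu,\nu$ and $k\in\mathbb{Z}$, choose $s,s'\ge0$ with $\ell(\nu)+s'-\ell(\mu)-s=k$ and set $\Phi(\mu,\nu,k)=\lambda(\{2m:m\in M_\mu+s\}\cup\{2m+1:m\in M_\nu+s'\})$ (independent of $s,s'$). Each partition is uniquely $\Phi(\mu,\nu,k)$ with $k\ge0$; $(\mu,\nu)$ is its 2-quotient and $(k,k-1,\dots,1)$ its 2-core $\bar\lambda$. There is a polynomial $R_\lambda$, monic of degree $|\mu|+|\nu|$, with $\mathrm{He}_\lambda(x)=x^{|\bar\lambda|}R_\lambda(x^2)$. Write $(\tilde\mu,\tilde\nu)<_j(\mu,\nu)$ if $\tilde\mu\subseteq\mu$,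 $\tilde\nu\subseteq\nu$ (inclusion of Young diagrams) and $|\tilde\mu|+|\tilde\nu|+j=|\mu|+|\nu|$. For such a pair, $\tilde\lambda=\Phi(\tilde\mu,\tilde\nu,k)$ is obtained from $\lambda$ by successively removing $j$ dominoes ($1\times2$ or $2\times1$ rectangles), each intermediate shape a Young diagram; $\mathrm{ht}_2(\lambda/\tilde\lambda)$ is the number of vertical dominoes removed (its parity is independent of the sequence). $H_{\mathrm{odd}}(\lambda)$ is the product of the odd hook lengths of $\lambda$. $F_{\alpha/\beta}$ is the number of saturated chains from $\beta$ to $\alpha$ in the Young lattice (partitions ordered by inclusion), $F_\alpha=F_{\alpha/\emptyset}$; $F^{(2)}_{(\mu,\nu)/(\tilde\mu,\tilde\nu)}=\binom{|\mu|-|\tilde\mu|+|\nu|-|\tilde\nu|}{|\mu|-|\tilde\mu|}F_{\mu/\tilde\mu}F_{\nu/\tilde\nu}$ (the number of saturated chains in $\mathbb{Y}\times\mathbb{Y}$) and $F^{(2)}_{(\mu,\nu)}=F^{(2)}_{(\mu,\nu)/(\emptyset,\emptyset)}$. *)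

theory Defs
  imports "HOL-Computational_Algebra.Polynomial" "HOL-Combinatorics.Permutations" "HOL-Library.Multiset"
begin

definition is_partition :: "nat list \<Rightarrow> bool" where
  "is_partition lam \<longleftrightarrow> sorted_wrt (\<ge>) lam \<and> (\<forall>x\<in>set lam. 0 < x)"

definition psize :: "nat list \<Rightarrow> nat" where
  "psize lam = sum_list lam"

definition cells :: "nat list \<Rightarrow> (nat \<times> nat) set" where
  "cells lam = {(i, j). i < length lam \<and> j < lam ! i}"

fun He :: "nat \<Rightarrow> real poly" where
  "He 0 = 1"
| "He (Suc 0) = [:0, 1:]"
| "He (Suc (Suc n)) = [:0, 1:] * He (Suc n) - smult (real (Suc n)) (He n)"

definition wronskian :: "real poly list \<Rightarrow> real poly" where
  "wronskian fs = (\<Sum>p | p permutes {..<length fs}.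
      of_int (sign p) * (\<Prod>i<length fs. (pderiv ^^ i) (fs ! (p i))))"

text \<open>Degree vector n_i = lambda_i + l - i (1-indexed), here 0-indexed.\<close>
definition degvec :: "nat list \<Rightarrow> nat list" where
  "degvec lam = map (\<lambda>i. lam ! i + (length lam - Suc i)) [0..<length lam]"

definition vandermonde :: "nat list \<Rightarrow> int" where
  "vandermonde lam = (\<Prod>(i, j) \<in> {(i, j). i < j \<and> j < length lam}.
      int (degvec lam ! j) - int (degvec lam ! i))"

definition HeP :: "nat list \<Rightarrow> real poly" where
  "HeP lam = smult (1 / real_of_int (vandermonde lam)) (wronskian (map He (degvec lam)))"

text \<open>R_lambda: the polynomial with He_lambda(x) = x^c R_lambda(x^2), c the size of the 2-core.\<close>
definition Rpoly :: "nat list \<Rightarrow> nat \<Rightarrow> real poly" where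
  "Rpoly lam c = (THE R. HeP lam = monom 1 c * pcompose R [:0, 0, 1:])"

definition maya_of :: "nat list \<Rightarrow> int set" where
  "maya_of lam = {n. n < 0} \<union> int ` set (degvec lam)"

definition maya_shift :: "int set \<Rightarrow> int \<Rightarrow> int set" where
  "maya_shift M t = (\<lambda>m. m + t) ` M"

definition maya_cnt :: "int set \<Rightarrow> int \<Rightarrow> nat" where
  "maya_cnt M m = card {n. n \<notin> M \<and> n < m}"

definition maya_part :: "int set \<Rightarrow> nat list" where
  "maya_part M = rev (sorted_list_of_multiset
      (image_mset (maya_cnt M) (mset_set {m \<in> M. 0 < maya_cnt M m})))"

text \<open>Phi(mu,nu,k) with the choice s = max 0 (-d), s' = max 0 d, d = k + l(mu) - l(nu),
  so that s, s' >= 0 and l(nu) + s' - l(mu) - s = k.\<close>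
definition Phi :: "nat list \<Rightarrow> nat list \<Rightarrow> int \<Rightarrow> nat list" where
  "Phi mu nu k = (let d = k + int (length mu) - int (length nu);
                      s = max 0 (- d); s' = max 0 d in
     maya_part ((\<lambda>m. 2 * m) ` maya_shift (maya_of mu) s
              \<union> (\<lambda>m. 2 * m + 1) ` maya_shift (maya_of nu) s'))"

inductive dchain :: "nat list \<Rightarrow> nat list \<Rightarrow> nat \<Rightarrow> bool" where
  dchain_refl: "dchain l l 0"
| dchain_hor: "is_partition m \<Longrightarrow> cells m \<subseteq> cells l \<Longrightarrow>
     cells l - cells m = {(i, j), (i, Suc j)} \<Longrightarrow> dchain m l' v \<Longrightarrow> dchain l l' v"
| dchain_ver: "is_partition m \<Longrightarrow> cells m \<subseteq> cells l \<Longrightarrow>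
     cells l - cells m = {(i, j), (Suc i, j)} \<Longrightarrow> dchain m l' v \<Longrightarrow> dchain l l' (Suc v)"

definition ht2 :: "nat list \<Rightarrow> nat list \<Rightarrow> nat" where
  "ht2 l l' = (SOME v. dchain l l' v)"

definition hook :: "nat list \<Rightarrow> nat \<times> nat \<Rightarrow> nat" where
  "hook lam c = (case c of (i, j) \<Rightarrow>
      ((lam ! i - j) + card {i'. i' < length lam \<and> j < lam ! i'}) - Suc i)"

definition Hodd :: "nat list \<Rightarrow> nat" where
  "Hodd lam = (\<Prod>c \<in> {c \<in> cells lam. odd (hook lam c)}. hook lam c)"

definition sat_chains :: "nat list \<Rightarrow> nat list \<Rightarrow> nat list list set" where
  "sat_chains a b = {cs. cs \<noteq> [] \<and> hd cs = b \<and> last cs = a \<and> (\<forall>x\<in>set cs. is_partition x) \<and>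
     (\<forall>i. Suc i < length cs \<longrightarrow> cells (cs ! i) \<subseteq> cells (cs ! Suc i) \<and>
          card (cells (cs ! Suc i) - cells (cs ! i)) = 1)}"

definition Fskew :: "nat list \<Rightarrow> nat list \<Rightarrow> nat" where
  "Fskew a b = card (sat_chains a b)"

definition F2skew :: "nat list \<Rightarrow> nat list \<Rightarrow> nat list \<Rightarrow> nat list \<Rightarrow> nat" where
  "F2skew mu nu mu' nu' =
     ((psize mu - psize mu' + (psize nu - psize nu')) choose (psize mu - psize mu'))
       * Fskew mu mu' * Fskew nu nu'"

definition F2 :: "nat list \<Rightarrow> nat list \<Rightarrow> nat" where
  "F2 mu nu = F2skew mu nu [] []"

definition pairs_below :: "nat \<Rightarrow> nat list \<Rightarrow> nat list \<Rightarrow> (nat list \<times> nat list) set" where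
  "pairs_below j mu nu = {(a, b). is_partition a \<and> is_partition b \<and>
      cells a \<subseteq> cells mu \<and> cells b \<subseteq> cells nu \<and> psize a + psize b + j = psize mu + psize nu}"

end

theory Submission
  imports Defs "Jordan_Normal_Form.Determinant"
begin

hide_const (open) Module.smult

text \<open>Up to a scalar, the Wronskian is the determinant of the matrix with entries h(n_i - j), where
  h(n) = He_n / n! and the n_i are the beta numbers of the partition. Since
  n h(n) = x h(n)' - h(n-2), applying x d/dx to this determinant gives the Euler-type identity
  (|lambda| - m) [x^m] = - (sum over the rows i of [x^m] of the determinant with n_i replaced
  by n_i - 2). If the even beta numbers are listed before the odd ones, then n_i - 2 is a decrement of
  one beta number of one component of the 2-quotient, and no sign occurs: the determinants with
  nonzero contribution correspond to the lower covers of (mu, nu). Iterating j times produces the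
  skew chain numbers and the factor (-1/2)^j / j!, and leaves leading coefficients. These are Vandermonde
  products over factorials, hence signed inverse hook products; the signs account for the vertical dominoes,
  the odd hooks give H_odd, and the even hooks are twice the hooks of the quotient. The same row
  identity for 1/n! in place of h(n) yields the hook length formula for the quotient.\<close>

section \<open>Determinants of functions\<close>

text \<open>Both row identities come from one weight count: if row \<open>i\<close> of a determinant
  is multiplied entrywise by \<open>r i + c j\<close>, then summing over \<open>i\<close> multiplies
  every permutation term by the same number, the total of all \<open>r i\<close> and
  \<open>c j\<close>. For \<open>r i\<close> the beta number and \<open>c j = - j\<close> this
  number is the size of the partition. The factor \<open>|lambda| - m\<close> vanishes at the top
  degree, so the recursion is silent there. The leading coefficient must be found separately; it is
  the same determinant with entries \<open>1/n!\<close>. Below the top the factor is twice the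
  number of boxes still to be removed from the quotient, and the successive divisions give
  \<open>(-1/2)^j / j!\<close>. The powers of 2 cancel against those of the even hooks, and the
  factorials of the hook length formula turn \<open>1/j!\<close> into the binomial coefficient. Only
  ratios of determinants with equal padding and equal row order occur. Hence the signs of padding
  and reordering drop out, and what survives is the relative order of even and odd beta numbers,
  which is exactly what domino removals change.\<close>

definition fdet :: "nat \<Rightarrow> (nat \<Rightarrow> nat \<Rightarrow> 'a::comm_ring_1) \<Rightarrow> 'a" where
  "fdet n A = det (mat n n (\<lambda>(i, j). A i j))"

lemma fdet_leibniz: "fdet n A = (\<Sum>p | p permutes {..<n}. of_int (sign p) * (\<Prod>i<n. A i (p i)))"
proof -
  have "fdet n A = (\<Sum>p | p permutes {0..<n}. of_int (sign p) * (\<Prod>i=0..<n. (mat n n (\<lambda>(i, j). A i j)) $$ (i, p i)))"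
    unfolding fdet_def by (subst det_def'[of _ n]) auto
  also have "\<dots> = (\<Sum>p | p permutes {..<n}. of_int (sign p) * (\<Prod>i<n. A i (p i)))"
    unfolding lessThan_atLeast0
    by (intro sum.cong prod.cong refl arg_cong2[of _ _ _ _ "(*)"])
       (auto simp: permutes_in_image)
  finally show ?thesis .
qed

lemma fdet_cong:
  assumes "\<And>i j. i < n \<Longrightarrow> j < n \<Longrightarrow> A i j = B i j"
  shows "fdet n A = fdet n B"
  unfolding fdet_def using assms by (intro arg_cong[of _ _ det] cong_mat) auto

text \<open>The cofactors along row \<open>i\<close> do not involve row \<open>i\<close>, so one
  vector \<open>c\<close> serves all replacement rows \<open>r\<close>. Linearity in a row then
  needs no further work on determinants.\<close>

lemma fdet_row_laplace:
  assumes "i < n"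
  obtains c where "\<And>r. fdet n (A(i := r)) = (\<Sum>j<n. r j * c j)"
proof -
  let ?M = "\<lambda>r. mat n n (\<lambda>(i', j). (A(i := r)) i' j)"
  have del: "mat_delete (?M r) i j = mat_delete (?M (\<lambda>_. 0)) i j" for r j
    unfolding mat_delete_def by (rule cong_mat) auto
  have "fdet n (A(i := r)) = (\<Sum>j<n. r j * cofactor (?M (\<lambda>_. 0)) i j)" for r
  proof -
    have "fdet n (A(i := r)) = (\<Sum>j<n. ?M r $$ (i, j) * cofactor (?M r) i j)"
      unfolding fdet_def by (rule laplace_expansion_row[OF _ assms]) simp
    also have "\<dots> = (\<Sum>j<n. r j * cofactor (?M (\<lambda>_. 0)) i j)"
      unfolding cofactor_def del[of r] using assms by (intro sum.cong) simp_all
    finally show ?thesis .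
  qed
  thus ?thesis using that by blast
qed

lemma fdet_row_add:
  assumes "i < n"
  shows "fdet n (A(i := \<lambda>j. u j + v j)) = fdet n (A(i := u)) + fdet n (A(i := v))"
proof -
  obtain c where c: "\<And>r. fdet n (A(i := r)) = (\<Sum>j<n. r j * c j)"
    using fdet_row_laplace[OF assms] by blast
  show ?thesis unfolding c by (simp add: distrib_right sum.distrib)
qed

lemma fdet_zero_row:
  assumes "i < n" and "\<And>j. j < n \<Longrightarrow> A i j = 0"
  shows "fdet n A = 0"
proof -
  obtain c where c: "\<And>r. fdet n (A(i := r)) = (\<Sum>j<n. r j * c j)"
    using fdet_row_laplace[OF assms(1)] by blast
  show ?thesis using c[of "A i"] assms(2) by simp
qed

lemma fdet_equal_rows:
  assumes "i < n" "i' < n" "i \<noteq> i'" and "\<And>j. j < n \<Longrightarrow> A i j = A i' j"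
  shows "fdet n A = 0"
  unfolding fdet_def using assms
  by (intro det_identical_rows[of _ n i i']) (auto intro!: eq_vecI)

lemma permutes_less_iff: "p permutes {..<n} \<Longrightarrow> p i < n \<longleftrightarrow> i < n"
  using permutes_in_image[of p "{..<n}" i] by simp

lemma fdet_permute_rows:
  assumes "p permutes {..<n}"
  shows "fdet n (\<lambda>i. A (p i)) = of_int (sign p) * fdet n A"
proof -
  have "fdet n (\<lambda>i. A (p i)) = det (mat n n (\<lambda>(i, j). mat n n (\<lambda>(i, j). A i j) $$ (p i, j)))"
    unfolding fdet_def using assms
    by (intro arg_cong[of _ _ det] cong_mat) (simp_all add: permutes_less_iff)
  also have "\<dots> = of_int (sign p) * fdet n A"
    using assms unfolding fdet_def by (subst det_permute_rows[of _ n]) (auto simp: lessThan_atLeast0)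
  finally show ?thesis .
qed

lemma fdet_transpose: "fdet n (\<lambda>i j. A j i) = fdet n A"
proof -
  have "mat n n (\<lambda>(i, j). A j i) = (mat n n (\<lambda>(i, j). A i j))\<^sup>T"
    by (auto intro!: eq_matI)
  thus ?thesis unfolding fdet_def by (metis det_transpose mat_carrier)
qed

lemma fdet_row_scale:
  "fdet n (\<lambda>i j. a i * A i j) = (\<Prod>i<n. a i) * fdet n A"
  unfolding fdet_leibniz by (simp add: prod.distrib sum_distrib_left mult_ac)

text \<open>In the term of a permutation \<open>p\<close> the modified row contributes the extra
  factor \<open>r i + c (p i)\<close>. Summed over \<open>i\<close>, the column weights are merely
  permuted, so the total does not depend on \<open>p\<close>.\<close>

lemma fdet_weights:
  "(\<Sum>i<n. fdet n (A(i := \<lambda>j. (r i + c j) * A i j))) = ((\<Sum>i<n. r i) + (\<Sum>j<n. c j)) * fdet n A"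
proof -
  have upd: "(\<Prod>i'<n. (A(i := \<lambda>j. (r i + c j) * A i j)) i' (p i')) = (r i + c (p i)) * (\<Prod>i<n. A i (p i))"
    if "i < n" for i p
  proof -
    have "(\<Prod>i'<n. (A(i := \<lambda>j. (r i + c j) * A i j)) i' (p i')) =
        (\<Prod>i'<n. (if i' = i then r i + c (p i) else 1) * A i' (p i'))"
      by (intro prod.cong) auto
    also have "\<dots> = (r i + c (p i)) * (\<Prod>i<n. A i (p i))"
      using that by (simp add: prod.distrib)
    finally show ?thesis .
  qed
  have "(\<Sum>i<n. fdet n (A(i := \<lambda>j. (r i + c j) * A i j))) =
      (\<Sum>i<n. \<Sum>p | p permutes {..<n}. of_int (sign p) * ((r i + c (p i)) * (\<Prod>i<n. A i (p i))))"
    unfolding fdet_leibniz by (intro sum.cong refl) (subst upd, auto)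
  also have "\<dots> = (\<Sum>p | p permutes {..<n}. (\<Sum>i<n. r i + c (p i)) * (of_int (sign p) * (\<Prod>i<n. A i (p i))))"
    by (subst sum.swap) (simp add: sum_distrib_right sum_distrib_left mult_ac)
  also have "\<dots> = (\<Sum>p | p permutes {..<n}. ((\<Sum>i<n. r i) + (\<Sum>j<n. c j)) * (of_int (sign p) * (\<Prod>i<n. A i (p i))))"
  proof (intro sum.cong refl arg_cong2[of _ _ _ _ "(*)"])
    fix p assume "p \<in> {p. p permutes {..<n}}"
    hence "(\<Sum>i<n. c (p i)) = (\<Sum>j<n. c j)"
      using sum.permute[of p "{..<n}" c] by (simp add: o_def)
    thus "(\<Sum>i<n. r i + c (p i)) = (\<Sum>i<n. r i) + (\<Sum>j<n. c j)" by (simp add: sum.distrib)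
  qed
  finally show ?thesis unfolding fdet_leibniz by (simp add: sum_distrib_left)
qed

lemma pderiv_sum: "pderiv (\<Sum>x\<in>S. f x) = (\<Sum>x\<in>S. pderiv (f x))"
  by (induction S rule: infinite_finite_induct) (auto simp: pderiv_add)

lemma pderiv_fdet:
  "pderiv (fdet n A) = (\<Sum>i<n. fdet n (A(i := \<lambda>j. pderiv (A i j))))"
  for A :: "nat \<Rightarrow> nat \<Rightarrow> 'a::{idom} poly"
proof -
  have upd: "(\<Prod>i'<n. (A(i := \<lambda>j. pderiv (A i j))) i' (p i')) = (\<Prod>i'\<in>{..<n}-{i}. A i' (p i')) * pderiv (A i (p i))"
    if "i < n" for i p
    using that by (subst prod.remove[of _ i]) (auto simp: mult.commute intro!: prod.cong)
  have sgn: "pderiv (of_int (sign p) * q) = of_int (sign p) * pderiv q" for p :: "nat \<Rightarrow> nat" and q :: "'a poly"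
    by (cases p rule: sign_cases) (auto simp: pderiv_minus)
  have "(\<Sum>i<n. fdet n (A(i := \<lambda>j. pderiv (A i j)))) =
     (\<Sum>i<n. \<Sum>p | p permutes {..<n}. of_int (sign p) * ((\<Prod>i'\<in>{..<n}-{i}. A i' (p i')) * pderiv (A i (p i))))"
    unfolding fdet_leibniz by (intro sum.cong refl) (subst upd, auto)
  also have "\<dots> = pderiv (fdet n A)"
    unfolding fdet_leibniz
    by (subst sum.swap) (simp add: pderiv_sum sgn pderiv_prod sum_distrib_left)
  finally show ?thesis ..
qed

section \<open>Jacobi-Trudi determinants of Hermite polynomials\<close>

lemma fdet_laplace_last:
  obtains c where "\<And>r. fdet (Suc n) (A(n := r)) = (\<Sum>j<n. r j * c j) + r n * fdet n A"
proof -
  let ?M = "\<lambda>r. mat (Suc n) (Suc n) (\<lambda>(i', j). (A(n := r)) i' j)"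
  have del: "mat_delete (?M r) n j = mat_delete (?M (\<lambda>_. 0)) n j" for r j
    unfolding mat_delete_def by (rule cong_mat) auto
  have last: "cofactor (?M (\<lambda>_. 0)) n n = fdet n A"
    unfolding cofactor_def fdet_def mat_delete_def by (auto intro!: arg_cong[of _ _ det] cong_mat)
  have "fdet (Suc n) (A(n := r)) = (\<Sum>j<n. r j * cofactor (?M (\<lambda>_. 0)) n j) + r n * fdet n A" for r
  proof -
    have "fdet (Suc n) (A(n := r)) = (\<Sum>j<Suc n. ?M r $$ (n, j) * cofactor (?M r) n j)"
      unfolding fdet_def by (rule laplace_expansion_row) simp_all
    also have "\<dots> = (\<Sum>j<Suc n. r j * cofactor (?M (\<lambda>_. 0)) n j)"
      unfolding cofactor_def del[of r] by (intro sum.cong) simp_all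
    finally show ?thesis using last by simp
  qed
  thus ?thesis using that by blast
qed

text \<open>As a polynomial in the last node, the determinant vanishes at the earlier nodes, and its
  leading coefficient is the smaller determinant. General monic \<open>q j\<close> are allowed
  because the application uses falling factorials instead of powers.\<close>

lemma fdet_vandermonde:
  fixes x :: "nat \<Rightarrow> real"
  assumes "\<And>j. degree (q j) \<le> j" "\<And>j. coeff (q j) j = 1"
  shows "fdet n (\<lambda>i j. poly (q j) (x i)) = (\<Prod>i<n. \<Prod>i'<i. x i - x i')"
proof (induction n)
  case 0
  show ?case by (simp add: fdet_leibniz)
next
  case (Suc n)
  let ?A = "\<lambda>i j. poly (q j) (x i)"
  show ?case
  proof (cases "inj_on x {..<Suc n}")
    case False
    then obtain i i' where i: "i < Suc n" "i' < Suc n" "i \<noteq> i'" "x i = x i'"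
      by (auto simp: inj_on_def)
    have 1: "fdet (Suc n) ?A = 0"
      by (rule fdet_equal_rows[OF i(1-3)]) (simp add: i(4))
    have "\<exists>i<Suc n. \<exists>i'<i. x i - x i' = 0"
      using i by (metis diff_self linorder_neqE_nat)
    hence "(\<Prod>i<Suc n. \<Prod>i'<i. x i - x i') = 0" by (auto simp del: prod.lessThan_Suc)
    with 1 show ?thesis by simp
  next
    case True
    obtain c where c: "\<And>r. fdet (Suc n) (?A(n := r)) = (\<Sum>j<n. r j * c j) + r n * fdet n ?A"
      using fdet_laplace_last by blast
    \<comment> \<open>\<open>P\<close> is the determinant with the last node made variable;
      \<open>T\<close> is the factorisation that its roots predict.\<close>
    define P where "P = (\<Sum>j<n. smult (c j) (q j)) + smult (fdet n ?A) (q n)"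
    define T where "T = smult (fdet n ?A) (\<Prod>i<n. [:- x i, 1:])"
    have P: "poly P y = fdet (Suc n) (?A(n := \<lambda>j. poly (q j) y))" for y
      unfolding c P_def by (simp add: poly_sum mult.commute)
    have dq: "degree (smult (c j) (q j)) < n" if "j < n" for j
      using assms(1)[of j] that by (meson degree_smult_le le_less_trans le_trans)
    have degP: "degree P \<le> n"
      unfolding P_def using assms(1) dq
      by (intro degree_add_le degree_sum_le) (auto intro: order_trans[OF degree_smult_le] less_imp_le simp del: degree_smult_eq)
    have degT': "degree (\<Prod>i<n. [:- x i, 1:]) = n"
      by (subst degree_prod_eq_sum_degree) auto
    have T': "lead_coeff (\<Prod>i<n. [:- x i, 1:]) = 1"
      by (simp add: lead_coeff_prod)
    \<comment> \<open>Both have degree at most \<open>n\<close> and the same coefficient at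
      \<open>n\<close>, so agreement at \<open>n\<close> distinct nodes suffices. This is where
      injectivity of \<open>x\<close> enters.\<close>
    have "P = T"
    proof (rule poly_eqI_degree_lead_coeff)
      have "coeff (smult (c j) (q j)) n = 0" if "j < n" for j
        using dq[OF that] by (simp only: coeff_eq_0)
      thus "coeff P n = coeff T n"
        unfolding P_def T_def using T' degT' assms(2)[of n] by (simp add: coeff_sum del: coeff_smult) simp
      show "degree P \<le> n" by (fact degP)
      show "degree T \<le> n" unfolding T_def using degT' by (metis degree_smult_le)
      show "n \<le> card (x ` {..<n})"
        using True by (subst card_image) (auto intro: inj_on_subset)
      fix z assume "z \<in> x ` {..<n}"
      then obtain i where i: "i < n" "z = x i" by auto
      have "poly P z = 0" unfolding P
        by (rule fdet_equal_rows[of i _ n]) (use i in auto)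
      moreover have "poly T z = 0"
        unfolding T_def using i by (auto simp: poly_prod)
      ultimately show "poly P z = poly T z" by simp
    qed
    have "fdet (Suc n) ?A = poly P (x n)"
      unfolding P by (rule fdet_cong) auto
    also have "\<dots> = fdet n ?A * (\<Prod>i<n. x n - x i)"
      unfolding \<open>P = T\<close> T_def by (simp add: poly_prod)
    finally show ?thesis using Suc by simp
  qed
qed

text \<open>A Jacobi-Trudi determinant with beta numbers \<open>f\<close>. Integer arguments let a
  decremented beta number become negative, where the sequences \<open>h\<close> in use are
  zero.\<close>

definition jtdet :: "(int \<Rightarrow> 'a::comm_ring_1) \<Rightarrow> nat \<Rightarrow> (nat \<Rightarrow> int) \<Rightarrow> 'a" where
  "jtdet h L f = fdet L (\<lambda>i j. h (f i - int j))"

lemma jtdet_cong: "(\<And>i. i < L \<Longrightarrow> f i = g i) \<Longrightarrow> jtdet h L f = jtdet h L g"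
  unfolding jtdet_def by (rule fdet_cong) simp

lemma jtdet_neg:
  assumes "\<And>m. m < 0 \<Longrightarrow> h m = 0" "i < L" "f i < 0"
  shows "jtdet h L f = 0"
  unfolding jtdet_def by (rule fdet_zero_row[of i]) (use assms in auto)

lemma jtdet_repeat:
  assumes "i < L" "i' < L" "i \<noteq> i'" "f i = f i'"
  shows "jtdet h L f = 0"
  unfolding jtdet_def by (rule fdet_equal_rows[of i L i']) (use assms in auto)

lemma jtdet_permute:
  "p permutes {..<L} \<Longrightarrow> jtdet h L (\<lambda>i. f (p i)) = of_int (sign p) * jtdet h L f"
  unfolding jtdet_def by (rule fdet_permute_rows)

text \<open>The row of the beta number 0 is \<open>(1, 0, ..., 0)\<close>. Expanding along it
  deletes column 0, which amounts to lowering all other beta numbers by one; the sign is that of the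
  position \<open>(L, 0)\<close>.\<close>

lemma jtdet_pad:
  assumes "\<And>m. m < 0 \<Longrightarrow> h m = 0" "h 0 = 1" "f L = 0"
  shows "jtdet h (Suc L) f = (-1) ^ L * jtdet h L (\<lambda>i. f i - 1)"
proof -
  let ?M = "mat (Suc L) (Suc L) (\<lambda>(i, j). h (f i - int j))"
  have "jtdet h (Suc L) f = (\<Sum>j<Suc L. ?M $$ (L, j) * cofactor ?M L j)"
    unfolding fdet_def jtdet_def by (rule laplace_expansion_row) simp_all
  also have "\<dots> = (\<Sum>j<Suc L. if j = 0 then cofactor ?M L 0 else 0)"
    by (intro sum.cong refl) (auto simp: assms)
  also have "\<dots> = cofactor ?M L 0" by (subst sum.delta) auto
  finally have "jtdet h (Suc L) f = cofactor ?M L 0" .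
  moreover have "mat_delete ?M L 0 = mat L L (\<lambda>(i, j). h (f i - 1 - int j))"
    unfolding mat_delete_def by (intro eq_matI) (auto intro!: arg_cong[of _ _ h])
  hence "cofactor ?M L 0 = (-1) ^ L * jtdet h L (\<lambda>i. f i - 1)"
    unfolding cofactor_def jtdet_def fdet_def by simp
  ultimately show ?thesis by simp
qed

section \<open>Reciprocal factorials and normalised Hermite polynomials\<close>

definition rfact :: "int \<Rightarrow> real" where
  "rfact m = (if m < 0 then 0 else 1 / fact (nat m))"

text \<open>Dividing by \<open>m!\<close> yields an Appell sequence: differentiation lowers the
  index by one without a factor, so Wronskians become Jacobi-Trudi determinants.\<close>

definition nHe :: "int \<Rightarrow> real poly" where
  "nHe m = smult (rfact m) (He (nat m))"

lemma rfact_neg: "m < 0 \<Longrightarrow> rfact m = 0" and rfact_0: "rfact 0 = 1"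
  by (auto simp: rfact_def)

lemma nHe_neg: "m < 0 \<Longrightarrow> nHe m = 0" and nHe_0: "nHe 0 = 1"
  by (auto simp: nHe_def rfact_def)

text \<open>The zero values at negative arguments make this valid for all integers: at
  \<open>m = 0\<close> both sides vanish.\<close>

lemma rfact_rec: "of_int m * rfact m = rfact (m - 1)"
proof (cases "m \<ge> 1")
  case True
  hence "nat m = Suc (nat (m - 1))" by simp
  thus ?thesis using True unfolding rfact_def by (simp add: field_simps)
qed (auto simp: rfact_def)

lemma pderiv_He: "pderiv (He n) = smult (real n) (He (n - 1))"
proof (induction n rule: He.induct)
  case (3 n)
  have "pderiv (He (Suc (Suc n))) = He (Suc n) + [:0,1:] * pderiv (He (Suc n)) - smult (real (Suc n)) (pderiv (He n))"
    by (simp add: pderiv_diff pderiv_mult pderiv_smult pderiv_pCons del: mult_pCons_left)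
  also have "\<dots> = He (Suc n) + smult (real (Suc n)) ([:0,1:] * He n - smult (real n) (He (n - 1)))"
    unfolding 3 by (simp add: smult_diff_right del: mult_pCons_left of_nat_Suc)
  also have "[:0,1:] * He n - smult (real n) (He (n - 1)) = He (Suc n)"
    by (cases n) simp_all
  also have "He (Suc n) + smult (real (Suc n)) (He (Suc n)) = smult (real (Suc (Suc n))) (He (Suc n))"
    by (metis (no_types, lifting) of_nat_Suc smult_1_left smult_add_left add.commute)
  finally show ?case by simp
qed (auto simp: pderiv_pCons)

lemma pderiv_nHe: "pderiv (nHe m) = nHe (m - 1)"
proof (cases "m \<ge> 0")
  case True
  have "pderiv (nHe m) = smult (of_int m * rfact m) (He (nat (m - 1)))"
    unfolding nHe_def pderiv_smult pderiv_He using True by (simp add: mult.commute nat_diff_distrib')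
  thus ?thesis unfolding rfact_rec nHe_def by simp
qed (simp add: nHe_neg)

text \<open>The three-term recurrence for \<open>He\<close>, divided by \<open>(m - 1)!\<close>, and
  true at the boundary cases by the zero convention. Since \<open>nHe (m - 1)\<close> is the
  derivative of \<open>nHe m\<close>, it expresses \<open>x d/dx\<close> through the index and a
  shift by two.\<close>

lemma nHe_rec: "[:0, 1:] * nHe (m - 1) = of_int m * nHe m + nHe (m - 2)"
proof (cases "m \<ge> 2")
  case True
  define n where "n = nat (m - 2)"
  have m: "m = int n + 2" using True n_def by simp
  have r: "rfact (int n + 2) * (real n + 2) = rfact (int n + 1)" "rfact (int n + 1) * (real n + 1) = rfact (int n)"
    using rfact_rec[of "int n + 2"] rfact_rec[of "int n + 1"] by (simp_all add: ac_simps)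
  have "nat (int n + 2) = Suc (Suc n)" "nat (int n + 1) = Suc n" by simp_all
  hence "of_int m * nHe m + nHe (m - 2) = smult (rfact (int n + 2) * (real n + 2)) (He (Suc (Suc n))) + smult (rfact (int n)) (He n)"
    unfolding nHe_def m by (simp add: of_int_poly mult.commute del: He.simps)
  also have "\<dots> = smult (rfact (int n + 1)) ([:0,1:] * He (Suc n)) + smult (rfact (int n) - rfact (int n + 1) * (real n + 1)) (He n)"
    unfolding r(1) He.simps by (simp add: smult_diff_right smult_diff_left algebra_simps del: mult_pCons_left)
  also have "\<dots> = [:0,1:] * nHe (m - 1)"
    unfolding r(2) nHe_def m using \<open>nat (int n + 1) = Suc n\<close>
    by (simp del: mult_pCons_left He.simps add: mult_smult_right add.commute)
  finally show ?thesis ..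
next
  case False
  then consider "m < 0" | "m = 0" | "m = 1" by linarith
  thus ?thesis by cases (auto simp: nHe_def rfact_def)
qed

lemma He_degree: "degree (He n) \<le> n" and He_monic: "coeff (He n) n = 1"
proof -
  have "degree (He n) \<le> n \<and> coeff (He n) n = 1"
  proof (induction n rule: He.induct)
    case (3 n)
    have "degree ([:0, 1:] * He (Suc n)) \<le> Suc (Suc n)"
      using 3(1) by (intro order_trans[OF degree_mult_le]) simp
    moreover have "degree (smult (real (Suc n)) (He n)) \<le> Suc (Suc n)"
      using 3(2) by (intro order_trans[OF degree_smult_le]) simp
    ultimately have "degree (He (Suc (Suc n))) \<le> Suc (Suc n)"
      unfolding He.simps by (rule degree_diff_le)
    moreover have "coeff (He n) (Suc (Suc n)) = 0"
      using 3(2) by (intro coeff_eq_0) simp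
    ultimately show ?case using 3 by simp
  qed auto
  thus "degree (He n) \<le> n" "coeff (He n) n = 1" by auto
qed

text \<open>Lowering \<open>f i\<close> multiplies the entries of row \<open>i\<close> by
  \<open>f i - j\<close>, so \<open>fdet_weights\<close> applies with row weights \<open>f i\<close>
  and column weights \<open>- j\<close>.\<close>

lemma jtdet_rfact_rec:
  "of_int ((\<Sum>i<L. f i) - (\<Sum>j<L. int j)) * jtdet rfact L f = (\<Sum>i<L. jtdet rfact L (f(i := f i - 1)))"
proof -
  have "(\<Sum>i<L. jtdet rfact L (f(i := f i - 1))) =
     (\<Sum>i<L. fdet L ((\<lambda>i j. rfact (f i - int j))(i := \<lambda>j. (of_int (f i) + - of_nat j) * rfact (f i - int j))))"
  proof (unfold jtdet_def, intro sum.cong refl fdet_cong)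
    fix i i' j
    have "rfact (f i - 1 - int j) = (of_int (f i) + - of_nat j) * rfact (f i - int j)"
      using rfact_rec[of "f i - int j"] by (simp add: algebra_simps)
    thus "rfact ((f(i := f i - 1)) i' - int j) =
        ((\<lambda>i j. rfact (f i - int j))(i := \<lambda>j. (of_int (f i) + - of_nat j) * rfact (f i - int j))) i' j"
      by simp
  qed
  also have "\<dots> = (of_int (\<Sum>i<L. f i) + - (\<Sum>j<L. of_nat j)) * jtdet rfact L f"
    by (subst fdet_weights) (simp add: jtdet_def sum_negf)
  finally show ?thesis by simp
qed

text \<open>Differentiate row by row. By \<open>nHe_rec\<close> each differentiated row, times
  \<open>x\<close>, is a weighted row plus the row shifted by two; the weighted parts are summed by
  \<open>fdet_weights\<close>.\<close>

lemma jtdet_nHe_rec: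
  "[:0, 1:] * pderiv (jtdet nHe L f) =
    of_int ((\<Sum>i<L. f i) - (\<Sum>j<L. int j)) * jtdet nHe L f + (\<Sum>i<L. jtdet nHe L (f(i := f i - 2)))"
proof -
  let ?A = "\<lambda>i j. nHe (f i - int j)"
  have row: "[:0, 1:] * fdet L (?A(i := \<lambda>j. pderiv (?A i j))) =
     fdet L (?A(i := \<lambda>j. (of_int (f i) + - of_nat j) * ?A i j)) + jtdet nHe L (f(i := f i - 2))"
    if i: "i < L" for i
  proof -
    have "[:0, 1:] * fdet L (?A(i := \<lambda>j. pderiv (?A i j))) = fdet L (?A(i := \<lambda>j. [:0, 1:] * pderiv (?A i j)))"
    proof -
      obtain c where c: "\<And>r. fdet L (?A(i := r)) = (\<Sum>j<L. r j * c j)"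
        using fdet_row_laplace[OF i] by blast
      show ?thesis unfolding c by (simp only: sum_distrib_left mult.assoc)
    qed
    also have "\<dots> = fdet L (?A(i := \<lambda>j. (of_int (f i) + - of_nat j) * ?A i j + nHe (f i - int j - 2)))"
      using nHe_rec[of "f i - int _"] by (intro arg_cong[of _ _ "fdet L"]) (simp only: pderiv_nHe nHe_rec of_int_diff of_int_of_nat_eq, simp)
    also have "\<dots> = fdet L (?A(i := \<lambda>j. (of_int (f i) + - of_nat j) * ?A i j)) + fdet L (?A(i := \<lambda>j. nHe (f i - int j - 2)))"
      by (rule fdet_row_add[OF i])
    also have "fdet L (?A(i := \<lambda>j. nHe (f i - int j - 2))) = jtdet nHe L (f(i := f i - 2))"
      unfolding jtdet_def by (rule fdet_cong) (simp add: algebra_simps)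
    finally show ?thesis .
  qed
  have "[:0, 1:] * pderiv (jtdet nHe L f) = (\<Sum>i<L. [:0, 1:] * fdet L (?A(i := \<lambda>j. pderiv (?A i j))))"
    unfolding jtdet_def pderiv_fdet by (rule sum_distrib_left)
  also have "\<dots> = (\<Sum>i<L. fdet L (?A(i := \<lambda>j. (of_int (f i) + - of_nat j) * ?A i j))) + (\<Sum>i<L. jtdet nHe L (f(i := f i - 2)))"
    unfolding sum.distrib[symmetric] by (intro sum.cong refl row) simp
  also have "(\<Sum>i<L. fdet L (?A(i := \<lambda>j. (of_int (f i) + - of_nat j) * ?A i j))) = of_int ((\<Sum>i<L. f i) - (\<Sum>j<L. int j)) * jtdet nHe L f"
    by (subst fdet_weights) (simp add: jtdet_def sum_negf)
  finally show ?thesis .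
qed

text \<open>This determines the coefficient except where the factor on the left is zero; that degree
  is the subject of \<open>coeff_jtdet_nHe_top\<close>.\<close>

lemma coeff_jtdet_nHe_rec:
  "(of_int ((\<Sum>i<L. f i) - (\<Sum>j<L. int j)) - real m) * coeff (jtdet nHe L f) m =
    - (\<Sum>i<L. coeff (jtdet nHe L (f(i := f i - 2))) m)"
proof -
  have "coeff ([:0, 1:] * pderiv (jtdet nHe L f)) m = real m * coeff (jtdet nHe L f) m"
    by (cases m) (simp_all add: coeff_pderiv)
  moreover have "coeff (of_int z * p) m = of_int z * coeff p m" for z and p :: "real poly"
    by (simp add: of_int_poly)
  ultimately show ?thesis
    using arg_cong[OF jtdet_nHe_rec[of L f], of "\<lambda>p. coeff p m"] by (simp add: coeff_sum algebra_simps del: of_int_diff)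
qed

text \<open>Only degree bounds are assumed, so a factor may have a vanishing coefficient at its
  bound. The two claims are joined because the induction for the coefficient uses the bound for the
  remaining product.\<close>

lemma coeff_prod_top:
  fixes g :: "'b \<Rightarrow> 'a::comm_semiring_1 poly"
  assumes "\<And>i. i \<in> S \<Longrightarrow> degree (g i) \<le> d i"
  shows "coeff (\<Prod>i\<in>S. g i) (\<Sum>i\<in>S. d i) = (\<Prod>i\<in>S. coeff (g i) (d i))
    \<and> degree (\<Prod>i\<in>S. g i) \<le> (\<Sum>i\<in>S. d i)"
  using assms
proof (induction S rule: infinite_finite_induct)
  case (insert x S)
  let ?p = "g x" and ?q = "\<Prod>i\<in>S. g i" and ?n = "\<Sum>i\<in>S. d i"
  have IH: "coeff ?q ?n = (\<Prod>i\<in>S. coeff (g i) (d i))" "degree ?q \<le> ?n"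
    using insert by auto
  have px: "degree ?p \<le> d x" using insert by auto
  have "coeff (?p * ?q) (d x + ?n) = (\<Sum>i\<le>d x + ?n. if i = d x then coeff ?p (d x) * coeff ?q ?n else 0)"
    unfolding coeff_mult
  proof (intro sum.cong refl)
    fix i assume "i \<in> {..d x + ?n}"
    show "coeff ?p i * coeff ?q (d x + ?n - i) = (if i = d x then coeff ?p (d x) * coeff ?q ?n else 0)"
    proof (cases i "d x" rule: linorder_cases)
      case less
      hence "coeff ?q (d x + ?n - i) = 0" using IH(2) by (intro coeff_eq_0) simp
      thus ?thesis using less by simp
    next
      case greater
      hence "coeff ?p i = 0" using px by (intro coeff_eq_0) simp
      thus ?thesis using greater by simp
    qed simp
  qed
  also have "\<dots> = coeff ?p (d x) * coeff ?q ?n" by simp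
  finally show ?case using insert IH px
    by (simp, intro order_trans[OF degree_mult_le] add_mono)
qed auto

text \<open>The indices in any permutation term add up to the same \<open>N\<close>, so every term
  contributes at degree \<open>N\<close> the product of its leading coefficients; \<open>He\<close>
  being monic, these are reciprocal factorials.\<close>

lemma coeff_jtdet_nHe_top:
  assumes N: "int N = (\<Sum>i<L. f i) - (\<Sum>j<L. int j)"
  shows "coeff (jtdet nHe L f) N = jtdet rfact L f"
proof -
  have summand: "coeff (\<Prod>i<L. nHe (f i - int (p i))) N = (\<Prod>i<L. rfact (f i - int (p i)))"
    if p: "p permutes {..<L}" for p
  \<comment> \<open>A negative index makes both products zero. Excluding it first ensures that the
    conversions by \<open>nat\<close> lose nothing in the degree count.\<close>
  proof (cases "\<exists>i<L. f i - int (p i) < 0")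
    case True
    then obtain i where i: "i < L" "f i - int (p i) < 0" by auto
    have "(\<Prod>i<L. nHe (f i - int (p i))) = 0" "(\<Prod>i<L. rfact (f i - int (p i))) = 0"
      using i by (auto intro!: prod_zero bexI[of _ i] nHe_neg rfact_neg)
    thus ?thesis by (simp only: coeff_0)
  next
    case False
    hence nn: "0 \<le> f i - int (p i)" if "i < L" for i using that by (meson not_less)
    have "int N = (\<Sum>i<L. f i - int (p i))"
      unfolding N using sum.permute[OF p, of int] by (simp add: sum_subtractf o_def)
    also have "\<dots> = int (\<Sum>i<L. nat (f i - int (p i)))"
      unfolding of_nat_sum using nn by (intro sum.cong) simp_all
    finally have N': "N = (\<Sum>i<L. nat (f i - int (p i)))" by linarith
    have "coeff (\<Prod>i<L. nHe (f i - int (p i))) N = (\<Prod>i<L. coeff (nHe (f i - int (p i))) (nat (f i - int (p i))))"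
      unfolding N' nHe_def
      by (rule coeff_prod_top[THEN conjunct1]) (intro order_trans[OF degree_smult_le] He_degree)
    thus ?thesis unfolding nHe_def by (simp add: He_monic)
  qed
  have "coeff (of_int z * p) N = of_int z * coeff p N" for z and p :: "real poly"
    by (simp add: of_int_poly)
  thus ?thesis unfolding jtdet_def fdet_leibniz by (simp add: coeff_sum summand)
qed

text \<open>Multiplying row \<open>i\<close> by the factorial of \<open>f i\<close> turns its
  entries into falling factorials of \<open>f i\<close>, monic polynomials of degree
  \<open>j\<close>, and the Vandermonde evaluation applies.\<close>

lemma jtdet_rfact_vandermonde:
  assumes "\<And>i. i < L \<Longrightarrow> 0 \<le> f i"
  shows "(\<Prod>i<L. fact (nat (f i))) * jtdet rfact L f = (\<Prod>i<L. \<Prod>i'<i. of_int (f i - f i'))"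
proof -
  define q :: "nat \<Rightarrow> real poly" where "q j = (\<Prod>t<j. [:- real t, 1:])" for j
  have q: "degree (q j) = j" "coeff (q j) j = 1" for j
  proof -
    show d: "degree (q j) = j" unfolding q_def by (subst degree_prod_eq_sum_degree) auto
    have "lead_coeff (q j) = 1" unfolding q_def by (simp add: lead_coeff_prod)
    thus "coeff (q j) j = 1" using d by simp
  qed
  \<comment> \<open>This also covers \<open>j > m\<close>: the left side is then zero by convention,
    and the falling factorial contains the factor zero.\<close>
  have e: "fact (nat m) * rfact (m - int j) = poly (q j) (of_int m)" if "0 \<le> m" for m j
  proof (induction j)
    case 0
    show ?case using that by (simp add: rfact_def q_def)
  next
    case (Suc j)
    have "rfact (m - int (Suc j)) = of_int (m - int j) * rfact (m - int j)"
      unfolding rfact_rec by (simp add: algebra_simps)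
    hence "fact (nat m) * rfact (m - int (Suc j)) = of_int (m - int j) * poly (q j) (of_int m)"
      unfolding Suc[symmetric] by (simp only: mult.left_commute)
    thus ?case by (simp add: q_def algebra_simps)
  qed
  have "(\<Prod>i<L. fact (nat (f i))) * jtdet rfact L f = fdet L (\<lambda>i j. poly (q j) (of_int (f i)))"
    unfolding jtdet_def fdet_row_scale[symmetric] using assms e by (intro fdet_cong) auto
  also have "\<dots> = (\<Prod>i<L. \<Prod>i'<i. of_int (f i) - of_int (f i'))"
    by (rule fdet_vandermonde) (simp_all add: q)
  finally show ?thesis by simp
qed

text \<open>By the Appell property the entries are \<open>fact n * nHe (n - j)\<close>, and the
  factorials come out of the rows. A transposition is needed because rows of the Wronskian matrix
  are derivative orders, while rows of \<open>jtdet\<close> are beta numbers.\<close>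

lemma wronskian_He:
  "wronskian (map He ns) = smult (\<Prod>i<length ns. fact (ns ! i)) (jtdet nHe (length ns) (\<lambda>i. int (ns ! i)))"
proof -
  let ?L = "length ns"
  have He: "He n = [:fact n:] * nHe (int n)" for n
    by (simp add: nHe_def rfact_def)
  have D: "(pderiv ^^ j) (He n) = [:fact n:] * nHe (int n - int j)" for n j
    by (induction j) (simp_all add: He pderiv_smult pderiv_nHe algebra_simps)
  have "wronskian (map He ns) = fdet ?L (\<lambda>j i. (pderiv ^^ j) (He (ns ! i)))"
    unfolding wronskian_def fdet_leibniz
    by (simp, intro sum.cong refl arg_cong2[of _ _ _ _ "(*)"] prod.cong) (auto simp: permutes_less_iff)
  also have "\<dots> = fdet ?L (\<lambda>i j. [:fact (ns ! i):] * nHe (int (ns ! i) - int j))"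
    unfolding D by (rule fdet_transpose[symmetric, of _ "\<lambda>j i. [:fact (ns ! i):] * nHe (int (ns ! i) - int j)"])
  also have "\<dots> = (\<Prod>i<?L. [:fact (ns ! i):]) * jtdet nHe ?L (\<lambda>i. int (ns ! i))"
    unfolding fdet_row_scale jtdet_def ..
  also have "(\<Prod>i<n. [:fact (ns ! i):]) = [:\<Prod>i<n. fact (ns ! i):]" for n
    by (induction n) (simp_all add: one_pCons algebra_simps)
  finally show ?thesis by simp
qed

text \<open>The Vandermonde product in the normalisation carries the same factorials as the
  Wronskian. They cancel, leaving a quotient of two determinants built on the same rows.\<close>

lemma HeP_eq_jtdet:
  "HeP lam = smult (1 / jtdet rfact (length lam) (\<lambda>i. int (degvec lam ! i))) (jtdet nHe (length lam) (\<lambda>i. int (degvec lam ! i)))"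
proof -
  let ?L = "length lam" and ?f = "\<lambda>i. int (degvec lam ! i)"
  have len: "length (degvec lam) = ?L" by (simp add: degvec_def)
  have "{(i, j). i < j \<and> j < ?L} = prod.swap ` (SIGMA j:{..<?L}. {..<j})"
    by (auto simp: image_iff)
  hence "vandermonde lam = (\<Prod>(j, i)\<in>(SIGMA j:{..<?L}. {..<j}). ?f j - ?f i)"
    unfolding vandermonde_def by (simp add: prod.reindex case_prod_unfold)
  also have "\<dots> = (\<Prod>j<?L. \<Prod>i<j. ?f j - ?f i)" by (rule prod.Sigma[symmetric]) auto
  finally have V: "real_of_int (vandermonde lam) = (\<Prod>j<?L. \<Prod>i<j. of_int (?f j - ?f i))" by simp
  have "(\<Prod>i<?L. fact (degvec lam ! i)) * jtdet rfact ?L ?f = real_of_int (vandermonde lam)"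
    unfolding V using jtdet_rfact_vandermonde[of ?L ?f] by simp
  moreover have "(\<Prod>i<?L. fact (degvec lam ! i)) \<noteq> (0::real)" by simp
  ultimately have "1 / real_of_int (vandermonde lam) * (\<Prod>i<?L. fact (degvec lam ! i)) = 1 / jtdet rfact ?L ?f"
    by (metis div_by_1 mult.right_neutral mult_divide_mult_cancel_left times_divide_eq_left mult_1)
  thus ?thesis unfolding HeP_def wronskian_He len by simp
qed

section \<open>Partitions, beta numbers and saturated chains\<close>

definition part :: "nat list \<Rightarrow> nat \<Rightarrow> nat" where
  "part lam i = (if i < length lam then lam ! i else 0)"

text \<open>The degree vector of \<open>lam\<close> padded with zero parts to \<open>L\<close> rows;
  the \<open>- 1\<close> is due to 0-based indexing. It is left unrestricted for \<open>i\<close>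
  beyond \<open>L\<close>, so that it is strictly decreasing, hence injective, on all
  indices.\<close>

definition beta :: "nat \<Rightarrow> nat list \<Rightarrow> nat \<Rightarrow> int" where
  "beta L lam i = int (part lam i) + int L - 1 - int i"

lemma part_antimono: "is_partition lam \<Longrightarrow> i \<le> j \<Longrightarrow> part lam j \<le> part lam i"
  unfolding is_partition_def part_def sorted_wrt_iff_nth_less
  by (cases "i = j") auto

lemma part_pos_iff: "is_partition lam \<Longrightarrow> 0 < part lam i \<longleftrightarrow> i < length lam"
  unfolding is_partition_def part_def by (auto dest: nth_mem)

lemma part_beyond: "length lam \<le> i \<Longrightarrow> part lam i = 0"
  by (simp add: part_def)

lemma part_Nil [simp]: "part [] i = 0"
  by (simp add: part_def)

lemma is_partition_Nil [simp]: "is_partition []"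
  by (simp add: is_partition_def)

lemma partition_eqI:
  assumes "is_partition a" "is_partition b" "\<And>i. part a i = part b i"
  shows "a = b"
proof (rule nth_equalityI)
  have "i < length a \<longleftrightarrow> i < length b" for i
    using part_pos_iff[OF assms(1)] part_pos_iff[OF assms(2)] assms(3) by metis
  thus l: "length a = length b" by (metis linorder_neqE_nat less_irrefl)
  fix i assume "i < length a"
  thus "a ! i = b ! i" using assms(3)[of i] l by (simp add: part_def)
qed

lemma partition_exists:
  assumes mono: "\<And>i. p (Suc i) \<le> p i" and zero: "p L = 0"
  obtains lam where "is_partition lam" "part lam = p" "length lam \<le> L"
proof -
  define n where "n = (LEAST i. p i = (0::nat))"
  have anti: "p j \<le> p i" if "i \<le> j" for i j
    using that mono by (rule lift_Suc_antimono_le[rotated])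
  have n: "p n = 0" unfolding n_def using zero by (rule LeastI)
  have pos: "p i > 0" if "i < n" for i
    using not_less_Least[of i "\<lambda>i. p i = 0"] that unfolding n_def by auto
  let ?lam = "map p [0..<n]"
  have "is_partition ?lam"
    unfolding is_partition_def by (auto simp: sorted_wrt_iff_nth_less anti pos)
  moreover have "part ?lam = p"
  proof
    fix i show "part ?lam i = p i"
      using n anti[of n i] by (cases "i < n") (auto simp: part_def)
  qed
  moreover have "length ?lam \<le> L"
    unfolding n_def using zero by (simp add: Least_le)
  ultimately show ?thesis using that by blast
qed

lemma cells_part: "cells lam = {(i, j). j < part lam i}"
  by (auto simp: cells_def part_def split: if_splits)

lemma cells_subset_iff: "cells a \<subseteq> cells b \<longleftrightarrow> (\<forall>i. part a i \<le> part b i)"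
proof
  assume "cells a \<subseteq> cells b"
  thus "\<forall>i. part a i \<le> part b i"
    unfolding cells_part by (auto simp: subset_iff) (meson leI less_irrefl)
next
  assume "\<forall>i. part a i \<le> part b i"
  thus "cells a \<subseteq> cells b"
    unfolding cells_part by (auto intro: less_le_trans)
qed

lemma length_le_of_subset:
  assumes "is_partition a" "is_partition b" "cells a \<subseteq> cells b"
  shows "length a \<le> length b"
proof (rule ccontr)
  assume "\<not> length a \<le> length b"
  hence "0 < part a (length b)" using part_pos_iff[OF assms(1)] by simp
  moreover have "part a (length b) \<le> part b (length b)"
    using assms(3) by (simp add: cells_subset_iff)
  ultimately show False by (simp add: part_beyond)
qed

lemma cells_eqI: "is_partition a \<Longrightarrow> is_partition b \<Longrightarrow> cells a = cells b \<Longrightarrow> a = b"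
  by (rule partition_eqI) (auto simp: cells_subset_iff set_eq_subset intro: antisym)

lemma psize_part: "length lam \<le> L \<Longrightarrow> psize lam = (\<Sum>i<L. part lam i)"
proof -
  assume L: "length lam \<le> L"
  have "psize lam = (\<Sum>i<length lam. part lam i)"
    by (simp add: psize_def sum_list_sum_nth lessThan_atLeast0 part_def)
  also have "\<dots> = (\<Sum>i<L. part lam i)"
    by (rule sum.mono_neutral_left) (use L in \<open>auto simp: part_def\<close>)
  finally show ?thesis .
qed

lemma cells_Sigma: "cells lam = (SIGMA i:{..<length lam}. {..<part lam i})"
  by (auto simp: cells_def part_def)

lemma finite_cells [simp]: "finite (cells lam)"
  by (simp add: cells_Sigma)

lemma card_cells: "card (cells lam) = psize lam"
  by (simp add: cells_Sigma psize_part[of lam "length lam"])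

lemma psize_mono: "cells a \<subseteq> cells b \<Longrightarrow> psize a \<le> psize b"
  by (metis card_cells card_mono finite_cells)

lemma psize_eq_imp:
  "is_partition a \<Longrightarrow> is_partition b \<Longrightarrow> cells a \<subseteq> cells b \<Longrightarrow> psize b \<le> psize a \<Longrightarrow> a = b"
  by (metis card_cells card_seteq cells_eqI finite_cells)

lemma beta_less: "is_partition lam \<Longrightarrow> i < j \<Longrightarrow> beta L lam j < beta L lam i"
  using part_antimono[of lam i j] by (simp add: beta_def)

lemma beta_nonneg: "i < L \<Longrightarrow> 0 \<le> beta L lam i"
  by (simp add: beta_def)

lemma beta_inj: "is_partition lam \<Longrightarrow> inj (beta L lam)"
  by (rule injI) (metis beta_less linorder_neqE_nat less_irrefl)

lemma sum_beta:
  assumes "length lam \<le> L"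
  shows "(\<Sum>i<L. beta L lam i) = int (psize lam) + (\<Sum>j<L. int j)"
proof -
  have "(\<Sum>i<L. beta L lam i) = int (psize lam) + (\<Sum>i<L. int L - 1 - int i)"
    by (simp add: psize_part[OF assms] beta_def sum.distrib[symmetric] sum_subtractf[symmetric] algebra_simps)
  also have "(\<Sum>i<L. int L - 1 - int i) = (\<Sum>i<L. int (L - Suc i))"
    by (intro sum.cong) auto
  also have "\<dots> = (\<Sum>j<L. int j)" by (rule sum.nat_diff_reindex)
  finally show ?thesis .
qed

section \<open>Covers and saturated chains in the Young lattice\<close>

definition lower_covers :: "nat list \<Rightarrow> nat list set" where
  "lower_covers mu = {m. is_partition m \<and> cells m \<subseteq> cells mu \<and> card (cells mu - cells m) = 1}"

lemma psize_lower_cover: "m \<in> lower_covers mu \<Longrightarrow> psize mu = Suc (psize m)"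
  unfolding lower_covers_def
  by (auto simp: card_Diff_subset card_cells dest: psize_mono)

lemma lower_covers_iff:
  assumes "is_partition mu"
  shows "m \<in> lower_covers mu \<longleftrightarrow>
    is_partition m \<and> (\<exists>i. part mu (Suc i) < part mu i \<and> part m = (part mu)(i := part mu i - 1))"
proof
  assume "m \<in> lower_covers mu"
  then obtain i j where m: "is_partition m" "\<And>i. part m i \<le> part mu i" and ij: "cells mu - cells m = {(i, j)}"
    unfolding lower_covers_def cells_subset_iff by (auto simp: card_1_singleton_iff)
  have diff: "part m i' \<le> j' \<and> j' < part mu i' \<longleftrightarrow> i' = i \<and> j' = j" for i' j'
  proof -
    have "(i', j') \<in> cells mu - cells m \<longleftrightarrow> i' = i \<and> j' = j" unfolding ij by simp
    thus ?thesis unfolding cells_part by (simp add: not_less conj_commute)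
  qed
  have other: "part m i' = part mu i'" if "i' \<noteq> i" for i'
    using diff[of i' "part m i'"] that m(2)[of i'] by auto
  have here: "part m i = j" "part mu i = Suc j"
    using diff[of i j] diff[of i "part m i"] diff[of i "Suc j"] by auto
  have "part mu (Suc i) < part mu i"
    using part_antimono[OF m(1), of i "Suc i"] other[of "Suc i"] here by simp
  moreover have "part m = (part mu)(i := part mu i - 1)"
    using other here by auto
  ultimately show "is_partition m \<and> (\<exists>i. part mu (Suc i) < part mu i \<and> part m = (part mu)(i := part mu i - 1))"
    using m by blast
next
  assume "is_partition m \<and> (\<exists>i. part mu (Suc i) < part mu i \<and> part m = (part mu)(i := part mu i - 1))"
  then obtain i where m: "is_partition m" "part mu (Suc i) < part mu i" "part m = (part mu)(i := part mu i - 1)"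
    by blast
  have "cells mu - cells m = {(i, part mu i - 1)}"
    unfolding cells_part using m(2,3) by (auto split: if_splits)
  thus "m \<in> lower_covers mu"
    unfolding lower_covers_def cells_subset_iff using m by auto
qed

lemma lower_coverE:
  assumes "m \<in> lower_covers mu"
  shows "is_partition m" "cells m \<subseteq> cells mu"
  using assms by (auto simp: lower_covers_def)

lemma remove_box:
  assumes "is_partition mu" "part mu (Suc i) < part mu i"
  obtains m where "is_partition m" "part m = (part mu)(i := part mu i - 1)" "length m \<le> length mu"
proof (rule partition_exists)
  show "((part mu)(i := part mu i - 1)) (Suc i') \<le> ((part mu)(i := part mu i - 1)) i'" for i'
    using assms part_antimono[OF assms(1), of i' "Suc i'"] by auto
  show "((part mu)(i := part mu i - 1)) (length mu) = 0"
    by (auto simp: part_beyond)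
qed (use that in blast)

lemma lower_covers_inj:
  assumes "is_partition mu" "part mu (Suc i) < part mu i" "part mu (Suc i') < part mu i'"
    "(part mu)(i := part mu i - 1) = (part mu)(i' := part mu i' - 1)"
  shows "i = i'"
  using fun_cong[OF assms(4), of i] assms(2) by (auto split: if_splits)

lemma finite_lower_covers: "is_partition mu \<Longrightarrow> finite (lower_covers mu)"
proof -
  assume mu: "is_partition mu"
  have "lower_covers mu \<subseteq> {xs. set xs \<subseteq> {..psize mu} \<and> length xs \<le> length mu}"
  proof
    fix m assume m: "m \<in> lower_covers mu"
    have "x \<le> psize mu" if "x \<in> set m" for x
      using member_le_sum_list[OF that] psize_mono[OF lower_coverE(2)[OF m]] by (simp add: psize_def)
    thus "m \<in> {xs. set xs \<subseteq> {..psize mu} \<and> length xs \<le> length mu}"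
      using length_le_of_subset[OF lower_coverE(1)[OF m] mu lower_coverE(2)[OF m]] by auto
  qed
  thus ?thesis by (rule finite_subset) (simp add: finite_lists_length_le)
qed

text \<open>On beta numbers, decrementing a row that is not a removable corner produces a repeated or a
  negative entry.\<close>

lemma sum_lower_covers:
  fixes G :: "(nat \<Rightarrow> int) \<Rightarrow> 'a::comm_monoid_add"
  assumes mu: "is_partition mu" "length mu \<le> L"
    and neg: "\<And>f i. i < L \<Longrightarrow> f i < 0 \<Longrightarrow> G f = 0"
    and repeat: "\<And>f i i'. i < L \<Longrightarrow> i' < L \<Longrightarrow> i \<noteq> i' \<Longrightarrow> f i = f i' \<Longrightarrow> G f = 0"
  shows "(\<Sum>m\<in>lower_covers mu. G (beta L m)) = (\<Sum>i<L. G ((beta L mu)(i := beta L mu i - 1)))"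
proof -
  define I where "I = {i. i < L \<and> part mu (Suc i) < part mu i}"
  have "\<exists>m. is_partition m \<and> part m = (part mu)(i := part mu i - 1)" if "i \<in> I" for i
    using remove_box[OF mu(1), of i] that unfolding I_def by blast
  then obtain m where m: "\<And>i. i \<in> I \<Longrightarrow> is_partition (m i)"
    "\<And>i. i \<in> I \<Longrightarrow> part (m i) = (part mu)(i := part mu i - 1)" by metis
  have "lower_covers mu = m ` I"
  proof (intro equalityI subsetI)
    fix a assume "a \<in> lower_covers mu"
    then obtain i where a: "is_partition a" "part mu (Suc i) < part mu i" "part a = (part mu)(i := part mu i - 1)"
      using lower_covers_iff[OF mu(1)] by blast
    have "i < L" using a(2) mu part_pos_iff[OF mu(1), of i] by linarith
    hence "i \<in> I" using a by (simp add: I_def)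
    moreover have "a = m i"
      by (rule partition_eqI) (use a m[OF \<open>i \<in> I\<close>] in auto)
    ultimately show "a \<in> m ` I" by blast
  next
    fix a assume "a \<in> m ` I"
    thus "a \<in> lower_covers mu" using lower_covers_iff[OF mu(1)] m unfolding I_def by auto
  qed
  moreover have "inj_on m I"
    using lower_covers_inj[OF mu(1)] m(2) unfolding I_def by (intro inj_onI) (metis (mono_tags, lifting) mem_Collect_eq)
  ultimately have "(\<Sum>m\<in>lower_covers mu. G (beta L m)) = (\<Sum>i\<in>I. G (beta L (m i)))"
    by (simp add: sum.reindex)
  also have "\<dots> = (\<Sum>i\<in>I. G ((beta L mu)(i := beta L mu i - 1)))"
  proof (intro sum.cong refl arg_cong[of _ _ G] ext)
    fix i i' assume "i \<in> I"
    thus "beta L (m i) i' = ((beta L mu)(i := beta L mu i - 1)) i'"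
      using m(2)[of i] by (auto simp: beta_def I_def)
  qed
  also have "\<dots> = (\<Sum>i<L. G ((beta L mu)(i := beta L mu i - 1)))"
  proof (rule sum.mono_neutral_left)
    show "\<forall>i\<in>{..<L} - I. G ((beta L mu)(i := beta L mu i - 1)) = 0"
    proof
      fix i assume i: "i \<in> {..<L} - I"
      hence eq: "part mu (Suc i) = part mu i"
        using part_antimono[OF mu(1), of i "Suc i"] by (auto simp: I_def)
      show "G ((beta L mu)(i := beta L mu i - 1)) = 0"
      proof (cases "Suc i < L")
        case True
        show ?thesis by (rule repeat[of i "Suc i"]) (use True eq in \<open>auto simp: beta_def\<close>)
      next
        case False
        hence "Suc i = L" using i by auto
        hence "part mu i = 0" using eq part_beyond[OF mu(2)] by auto
        thus ?thesis using \<open>Suc i = L\<close> by (intro neg[of i]) (auto simp: beta_def)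
      qed
    qed
  qed (auto simp: I_def)
  finally show ?thesis .
qed

lemma sat_chains_self:
  assumes "is_partition a"
  shows "sat_chains a a = {[a]}"
proof (intro equalityI subsetI)
  fix cs assume cs: "cs \<in> sat_chains a a"
  \<comment> \<open>Sizes grow by exactly one per step, so a chain with equal ends has a single
    element.\<close>
  have inc: "psize (cs ! i) + d = psize (cs ! (i + d))" if "i + d < length cs" for i d
    using that
  proof (induction d)
    case (Suc d)
    have "cells (cs ! (i + d)) \<subseteq> cells (cs ! Suc (i + d))" "card (cells (cs ! Suc (i + d)) - cells (cs ! (i + d))) = 1"
      using cs Suc.prems unfolding sat_chains_def by auto
    hence "psize (cs ! Suc (i + d)) = Suc (psize (cs ! (i + d)))"
      using psize_mono[of "cs ! (i + d)" "cs ! Suc (i + d)"] by (auto simp: card_Diff_subset card_cells)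
    thus ?case using Suc by auto
  qed simp
  have "cs \<noteq> []" "cs ! 0 = a" "cs ! (length cs - 1) = a"
    using cs by (auto simp: sat_chains_def hd_conv_nth last_conv_nth)
  with inc[of 0 "length cs - 1"] have "length cs = 1" by (cases cs) auto
  thus "cs \<in> {[a]}" using cs by (auto simp: sat_chains_def length_Suc_conv)
qed (use assms in \<open>auto simp: sat_chains_def\<close>)

lemma sat_chains_rec:
  assumes mu: "is_partition mu" and "mu \<noteq> b"
  shows "sat_chains mu b = (\<Union>m\<in>lower_covers mu. (\<lambda>cs. cs @ [mu]) ` sat_chains m b)"
proof (intro equalityI subsetI)
  fix cs assume cs: "cs \<in> sat_chains mu b"
  hence "cs \<noteq> []" "last cs = mu" by (simp_all add: sat_chains_def)
  then obtain cs' where cs': "cs = cs' @ [mu]"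
    by (metis append_butlast_last_id)
  have parts: "\<forall>x\<in>set cs. is_partition x" and hd: "hd cs = b" using cs by (simp_all add: sat_chains_def)
  have ne: "cs' \<noteq> []" using hd assms(2) unfolding cs' by auto
  let ?m = "last cs'"
  have step: "Suc i < length cs \<longrightarrow> cells (cs ! i) \<subseteq> cells (cs ! Suc i) \<and> card (cells (cs ! Suc i) - cells (cs ! i)) = 1" for i
    using cs by (simp add: sat_chains_def)
  have "?m \<in> lower_covers mu"
    using step[of "length cs' - 1"] ne parts unfolding lower_covers_def cs'
    by (auto simp: nth_append last_conv_nth)
  moreover have "cs' \<in> sat_chains ?m b"
  proof -
    have "cells (cs' ! i) \<subseteq> cells (cs' ! Suc i) \<and> card (cells (cs' ! Suc i) - cells (cs' ! i)) = 1"
      if "Suc i < length cs'" for i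
      using step[of i] that unfolding cs' by (simp add: nth_append)
    thus ?thesis using ne parts hd unfolding sat_chains_def cs' by simp
  qed
  ultimately show "cs \<in> (\<Union>m\<in>lower_covers mu. (\<lambda>cs. cs @ [mu]) ` sat_chains m b)"
    using cs' by blast
next
  fix cs assume "cs \<in> (\<Union>m\<in>lower_covers mu. (\<lambda>cs. cs @ [mu]) ` sat_chains m b)"
  then obtain m cs' where m: "m \<in> lower_covers mu" and cs': "cs' \<in> sat_chains m b" and cs: "cs = cs' @ [mu]"
    by blast
  have "cells (cs ! i) \<subseteq> cells (cs ! Suc i) \<and> card (cells (cs ! Suc i) - cells (cs ! i)) = 1"
    if i: "Suc i < length cs" for i
  proof (cases "Suc i < length cs'")
    case True
    thus ?thesis using cs' unfolding cs sat_chains_def by (simp add: nth_append)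
  next
    case False
    have ne: "cs' \<noteq> []" and last: "last cs' = m" using cs' by (simp_all add: sat_chains_def)
    have "i = length cs' - 1" using False i cs by simp
    hence "cs ! i = m" "cs ! Suc i = mu"
      using ne last unfolding cs by (simp_all add: nth_append last_conv_nth)
    thus ?thesis using m by (simp add: lower_covers_def)
  qed
  thus "cs \<in> sat_chains mu b"
    using cs' mu unfolding sat_chains_def cs by simp
qed

lemma finite_sat_chains: "is_partition mu \<Longrightarrow> finite (sat_chains mu b)"
proof (induction "psize mu" arbitrary: mu rule: less_induct)
  case less
  show ?case
  proof (cases "mu = b")
    case True
    thus ?thesis using sat_chains_self less by simp
  next
    case False
    show ?thesis unfolding sat_chains_rec[OF less.prems False]
      using less psize_lower_cover lower_coverE finite_lower_covers[OF less.prems]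
      by (intro finite_UN_I finite_imageI) auto
  qed
qed

lemma Fskew_self: "is_partition a \<Longrightarrow> Fskew a a = 1"
  by (simp add: Fskew_def sat_chains_self)

lemma Fskew_rec:
  assumes mu: "is_partition mu" and "mu \<noteq> b"
  shows "Fskew mu b = (\<Sum>m\<in>lower_covers mu. Fskew m b)"
proof -
  have disj: "(\<lambda>cs. cs @ [mu]) ` sat_chains m b \<inter> (\<lambda>cs. cs @ [mu]) ` sat_chains m' b = {}" if "m \<noteq> m'" for m m'
    using that by (auto simp: sat_chains_def)
  have "Fskew mu b = (\<Sum>m\<in>lower_covers mu. card ((\<lambda>cs. cs @ [mu]) ` sat_chains m b))"
    unfolding Fskew_def sat_chains_rec[OF assms]
    using disj finite_sat_chains lower_coverE(1) finite_lower_covers[OF mu]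
    by (intro card_UN_disjoint) auto
  thus ?thesis by (simp add: Fskew_def card_image inj_on_def)
qed

text \<open>With this, chain counts for different upper ends can be summed over one common index set
  in the induction of \<open>coeff_jtdet_gam\<close>.\<close>

lemma Fskew_zero:
  assumes "is_partition mu" "\<not> cells b \<subseteq> cells mu"
  shows "Fskew mu b = 0"
  using assms
proof (induction "psize mu" arbitrary: mu rule: less_induct)
  case less
  have "mu \<noteq> b" using less.prems by auto
  have "Fskew m b = 0" if "m \<in> lower_covers mu" for m
    using less.hyps[of m] less.prems that psize_lower_cover lower_coverE by fastforce
  thus ?case using Fskew_rec[OF less.prems(1) \<open>mu \<noteq> b\<close>] by simp
qed

lemma F2skew_zero:
  assumes "is_partition mu" "is_partition nu" "\<not> (cells a \<subseteq> cells mu \<and> cells b \<subseteq> cells nu)"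
  shows "F2skew mu nu a b = 0"
  unfolding F2skew_def using assms Fskew_zero by (metis mult_0_right mult_zero_left)

lemma F2skew_self: "is_partition a \<Longrightarrow> is_partition b \<Longrightarrow> F2skew a b a b = 1"
  by (simp add: F2skew_def Fskew_self)

text \<open>The last step of a chain in the product lattice lies in one of the two components. For
  the binomial prefactor this is Pascal's rule; the cases where one component is already reached are
  separated because truncated subtraction breaks the rule there.\<close>

lemma F2skew_rec:
  assumes mu: "is_partition mu" and nu: "is_partition nu" and a: "is_partition a" and b: "is_partition b"
    and sub: "cells a \<subseteq> cells mu" "cells b \<subseteq> cells nu" and ne: "(a, b) \<noteq> (mu, nu)"
  shows "F2skew mu nu a b = (\<Sum>m\<in>lower_covers mu. F2skew m nu a b) + (\<Sum>n\<in>lower_covers nu. F2skew mu n a b)"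
proof -
  define M N where "M = psize mu - psize a" and "N = psize nu - psize b"
  \<comment> \<open>No chain descends from a partition to something larger, so a component that is
    already equal contributes nothing.\<close>
  have self: "Fskew m mu' = 0" if "m \<in> lower_covers mu'" for m mu'
    using that psize_lower_cover[OF that] psize_mono[of mu' m] lower_coverE
    by (intro Fskew_zero) auto
  have szm: "psize m - psize a = M - 1" if "m \<in> lower_covers mu" for m
    using psize_lower_cover[OF that] by (simp add: M_def)
  have szn: "psize n - psize b = N - 1" if "n \<in> lower_covers nu" for n
    using psize_lower_cover[OF that] by (simp add: N_def)
  have L: "(\<Sum>m\<in>lower_covers mu. F2skew m nu a b) = ((M - 1 + N) choose (M - 1)) * (\<Sum>m\<in>lower_covers mu. Fskew m a) * Fskew nu b"
    unfolding sum_distrib_left sum_distrib_right F2skew_def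
    by (intro sum.cong) (simp_all add: szm N_def)
  have R: "(\<Sum>n\<in>lower_covers nu. F2skew mu n a b) = ((M + (N - 1)) choose M) * Fskew mu a * (\<Sum>n\<in>lower_covers nu. Fskew n b)"
    unfolding sum_distrib_left sum_distrib_right F2skew_def
    by (intro sum.cong) (simp_all add: szn M_def)
  have T: "F2skew mu nu a b = ((M + N) choose M) * Fskew mu a * Fskew nu b"
    by (simp add: F2skew_def M_def N_def)
  have M0: "M > 0" if "a \<noteq> mu"
    using that psize_eq_imp[OF a mu sub(1)] by (force simp: M_def)
  have N0: "N > 0" if "b \<noteq> nu"
    using that psize_eq_imp[OF b nu sub(2)] by (force simp: N_def)
  consider "a = mu" "b \<noteq> nu" | "a \<noteq> mu" "b = nu" | "a \<noteq> mu" "b \<noteq> nu" using ne by auto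
  thus ?thesis
  proof cases
    case 1
    hence "(\<Sum>m\<in>lower_covers mu. Fskew m a) = 0" using self by simp
    moreover have "M = 0" using 1 by (simp add: M_def)
    ultimately show ?thesis unfolding L R T using Fskew_rec[OF nu] 1 by simp
  next
    case 2
    hence "(\<Sum>n\<in>lower_covers nu. Fskew n b) = 0" using self by simp
    moreover have "N = 0" using 2 by (simp add: N_def)
    ultimately show ?thesis unfolding L R T using Fskew_rec[OF mu] 2 by simp
  next
    case 3
    obtain M' N' where MN: "M = Suc M'" "N = Suc N'"
      using M0 N0 3 by (metis gr0_conv_Suc)
    have "(M + N) choose M = ((M - 1 + N) choose (M - 1)) + ((M + (N - 1)) choose M)"
      unfolding MN by simp
    thus ?thesis unfolding L R T using Fskew_rec[OF mu] Fskew_rec[OF nu] 3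
      by (simp add: add_mult_distrib)
  qed
qed

section \<open>Expansion of the woven determinant\<close>

definition gam :: "nat \<Rightarrow> nat \<Rightarrow> nat list \<Rightarrow> nat list \<Rightarrow> nat \<Rightarrow> int" where
  "gam L1 L2 mu nu i = (if i < L1 then 2 * beta L1 mu i else 2 * beta L2 nu (i - L1) + 1)"

lemma sum_lessThan_add:
  fixes f :: "nat \<Rightarrow> 'a::comm_monoid_add"
  shows "(\<Sum>i<a + b. f i) = (\<Sum>i<a. f i) + (\<Sum>i<b. f (a + i))"
  by (induction b) (simp_all add: add.assoc)

lemma prod_lessThan_add:
  fixes f :: "nat \<Rightarrow> 'a::comm_monoid_mult"
  shows "(\<Prod>i<a + b. f i) = (\<Prod>i<a. f i) * (\<Prod>i<b. f (a + i))"
  by (induction b) (simp_all add: mult.assoc)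

text \<open>This is \<open>|lambda|\<close>, the core size plus twice the quotient size. With
  \<open>L2 = L1 + k\<close> the padding contributions collapse to \<open>k (k + 1) / 2\<close>; the
  computation is done on the doubled identity to avoid division.\<close>

lemma sum_gam:
  assumes "length mu \<le> L1" "length nu \<le> L2" "L2 = L1 + k"
  shows "(\<Sum>i<L1 + L2. gam L1 L2 mu nu i) - (\<Sum>j<L1 + L2. int j) =
    int ((\<Sum>i=1..k. i) + 2 * (psize mu + psize nu))"
proof -
  have two: "2 * (\<Sum>j<n. int j) = int n * (int n - 1)" for n
    by (induction n) (simp_all add: algebra_simps)
  have k: "2 * int (\<Sum>i=1..k. i) = int k * (int k + 1)"
    by (induction k) (simp_all add: algebra_simps)
  have "(\<Sum>i<L1 + L2. gam L1 L2 mu nu i) = 2 * (\<Sum>i<L1. beta L1 mu i) + 2 * (\<Sum>i<L2. beta L2 nu i) + int L2"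
    by (simp add: sum_lessThan_add gam_def sum_distrib_left sum.distrib)
  also have "\<dots> = 2 * int (psize mu) + 2 * int (psize nu) + int L1 * (int L1 - 1) + int L2 * (int L2 - 1) + int L2"
    using two[of L1] two[of L2] by (simp add: sum_beta assms(1,2) algebra_simps)
  finally have "2 * ((\<Sum>i<L1 + L2. gam L1 L2 mu nu i) - (\<Sum>j<L1 + L2. int j)) =
    4 * int (psize mu) + 4 * int (psize nu) + 2 * (int L1 * (int L1 - 1)) + 2 * (int L2 * (int L2 - 1)) + 2 * int L2
     - int (L1 + L2) * (int (L1 + L2) - 1)"
    using two[of "L1 + L2"] by (simp only: right_diff_distrib distrib_left)
  also have "\<dots> = 4 * int (psize mu) + 4 * int (psize nu) + int k * (int k + 1)"
    unfolding assms(3) by (simp add: algebra_simps)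
  also have "\<dots> = 2 * int ((\<Sum>i=1..k. i) + 2 * (psize mu + psize nu))"
    using k by (simp add: algebra_simps)
  finally show ?thesis by simp
qed

text \<open>The rows split into two blocks, and a shift by two in a block is a unit decrement of one
  beta number of that component. \<open>sum_lower_covers\<close> then applies to each block with the
  other held fixed.\<close>

lemma sum_moves_gam:
  fixes L1 L2 :: nat
  assumes mu: "is_partition mu" "length mu \<le> L1" and nu: "is_partition nu" "length nu \<le> L2"
  defines "g \<equiv> gam L1 L2 mu nu"
  shows "(\<Sum>i<L1 + L2. coeff (jtdet nHe (L1 + L2) (g(i := g i - 2))) d) =
    (\<Sum>m\<in>lower_covers mu. coeff (jtdet nHe (L1 + L2) (gam L1 L2 m nu)) d) +
    (\<Sum>n\<in>lower_covers nu. coeff (jtdet nHe (L1 + L2) (gam L1 L2 mu n)) d)"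
proof -
  let ?D = "\<lambda>f. coeff (jtdet nHe (L1 + L2) f) d"
  define G1 where "G1 f = ?D (\<lambda>i. if i < L1 then 2 * f i else 2 * beta L2 nu (i - L1) + 1)" for f :: "nat \<Rightarrow> int"
  define G2 where "G2 f = ?D (\<lambda>i. if i < L1 then 2 * beta L1 mu i else 2 * f (i - L1) + 1)" for f :: "nat \<Rightarrow> int"
  have "(\<Sum>m\<in>lower_covers mu. G1 (beta L1 m)) = (\<Sum>i<L1. G1 ((beta L1 mu)(i := beta L1 mu i - 1)))"
  proof (rule sum_lower_covers[OF mu])
    show "G1 f = 0" if "i < L1" "f i < 0" for f i
      unfolding G1_def using that by (subst jtdet_neg[of _ i]) (auto simp: nHe_neg)
    show "G1 f = 0" if "i < L1" "i' < L1" "i \<noteq> i'" "f i = f i'" for f i i'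
      unfolding G1_def using that by (subst jtdet_repeat[of i _ i']) auto
  qed
  moreover have "(\<Sum>n\<in>lower_covers nu. G2 (beta L2 n)) = (\<Sum>i<L2. G2 ((beta L2 nu)(i := beta L2 nu i - 1)))"
  proof (rule sum_lower_covers[OF nu])
    show "G2 f = 0" if "i < L2" "f i < 0" for f i
      unfolding G2_def using that by (subst jtdet_neg[of _ "L1 + i"]) (auto simp: nHe_neg)
    show "G2 f = 0" if "i < L2" "i' < L2" "i \<noteq> i'" "f i = f i'" for f i i'
      unfolding G2_def using that by (subst jtdet_repeat[of "L1 + i" _ "L1 + i'"]) auto
  qed
  moreover have "G1 ((beta L1 mu)(i := beta L1 mu i - 1)) = ?D (g(i := g i - 2))" if "i < L1" for i
    unfolding G1_def g_def gam_def using that by (intro arg_cong[of _ _ ?D] ext) auto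
  moreover have "G2 ((beta L2 nu)(i := beta L2 nu i - 1)) = ?D (g(L1 + i := g (L1 + i) - 2))" for i
    unfolding G2_def g_def gam_def by (intro arg_cong[of _ _ ?D] ext) auto
  moreover have "G1 (beta L1 m) = ?D (gam L1 L2 m nu)" "G2 (beta L2 m) = ?D (gam L1 L2 mu m)" for m
    unfolding G1_def G2_def gam_def by simp_all
  ultimately show ?thesis unfolding sum_lessThan_add by simp
qed

definition below :: "nat list \<Rightarrow> nat list \<Rightarrow> (nat list \<times> nat list) set" where
  "below mu nu = {(a, b). is_partition a \<and> is_partition b \<and> cells a \<subseteq> cells mu \<and> cells b \<subseteq> cells nu}"

lemma finite_subpartitions: "is_partition mu \<Longrightarrow> finite {a. is_partition a \<and> cells a \<subseteq> cells mu}"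
proof -
  assume mu: "is_partition mu"
  have "inj_on cells {a. is_partition a \<and> cells a \<subseteq> cells mu}"
    by (intro inj_onI cells_eqI) auto
  moreover have "finite (cells ` {a. is_partition a \<and> cells a \<subseteq> cells mu})"
    by (rule finite_subset[of _ "Pow (cells mu)"]) auto
  ultimately show ?thesis by (rule finite_imageD[rotated])
qed

lemma finite_below: "is_partition mu \<Longrightarrow> is_partition nu \<Longrightarrow> finite (below mu nu)"
  by (rule finite_subset[OF _ finite_cartesian_product[OF finite_subpartitions[of mu] finite_subpartitions[of nu]]])
     (auto simp: below_def)

lemma below_lower_cover:
  "m \<in> lower_covers mu \<Longrightarrow> below m nu \<subseteq> below mu nu"
  "n \<in> lower_covers nu \<Longrightarrow> below mu n \<subseteq> below mu nu"
  by (auto simp: below_def dest: lower_coverE)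

text \<open>Induction on the size of the quotient. Away from the top degree the row recursion
  reduces to lower covers, and the summands obey the same recursion pair by pair, by
  \<open>F2skew_rec\<close>.\<close>

lemma coeff_jtdet_gam:
  assumes "is_partition mu" "length mu \<le> L1" "is_partition nu" "length nu \<le> L2" "L2 = L1 + k"
  shows "coeff (jtdet nHe (L1 + L2) (gam L1 L2 mu nu)) d =
    (\<Sum>(a, b)\<in>below mu nu. if d = (\<Sum>i=1..k. i) + 2 * (psize a + psize b)
      then (- 1 / 2) ^ (psize mu + psize nu - (psize a + psize b)) / fact (psize mu + psize nu - (psize a + psize b))
        * real (F2skew mu nu a b) * jtdet rfact (L1 + L2) (gam L1 L2 a b)
      else 0)"
  using assms(1-4)
proof (induction "psize mu + psize nu" arbitrary: mu nu rule: less_induct)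
  case less
  define c where "c = (\<Sum>i=1..k. i)"
  define T where "T mu nu ab = (case ab of (a, b) \<Rightarrow> if d = c + 2 * (psize a + psize b)
      then (- 1 / 2) ^ (psize mu + psize nu - (psize a + psize b)) / fact (psize mu + psize nu - (psize a + psize b))
        * real (F2skew mu nu a b) * jtdet rfact (L1 + L2) (gam L1 L2 a b)
      else 0)" for mu nu :: "nat list" and ab
  let ?N = "psize mu + psize nu"
  let ?C = "\<lambda>mu nu. coeff (jtdet nHe (L1 + L2) (gam L1 L2 mu nu)) d"
  note mu = less.prems(1,2) and nu = less.prems(3,4)
  note [intro] = finite_below[OF mu(1) nu(1)]
  have size: "psize a + psize b < ?N" if "(a, b) \<in> below mu nu" "(a, b) \<noteq> (mu, nu)" for a b
  proof -
    have ab: "is_partition a" "is_partition b" "cells a \<subseteq> cells mu" "cells b \<subseteq> cells nu"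
      using that(1) by (auto simp: below_def)
    have "psize a \<le> psize mu" "psize b \<le> psize nu" using ab psize_mono by auto
    moreover have "psize a < psize mu \<or> psize b < psize nu"
      using that(2) psize_eq_imp[OF ab(1) mu(1) ab(3)] psize_eq_imp[OF ab(2) nu(1) ab(4)] by force
    ultimately show ?thesis by linarith
  qed
  have self: "(mu, nu) \<in> below mu nu" using mu nu by (auto simp: below_def)
  have "?C mu nu = (\<Sum>ab\<in>below mu nu. T mu nu ab)"
  proof (cases "d = c + 2 * ?N")
    \<comment> \<open>At the top degree all other pairs below \<open>(mu, nu)\<close> are too small
      by \<open>size\<close>, and the summand of \<open>(mu, nu)\<close> itself has factor
      1.\<close>
    case True
    have "T mu nu ab = (if ab = (mu, nu) then jtdet rfact (L1 + L2) (gam L1 L2 mu nu) else 0)"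
      if "ab \<in> below mu nu" for ab
      using size[of "fst ab" "snd ab"] that mu nu
      by (auto simp: T_def True F2skew_self split: prod.splits)
    hence "(\<Sum>ab\<in>below mu nu. T mu nu ab) = jtdet rfact (L1 + L2) (gam L1 L2 mu nu)"
      using self by (simp add: sum.delta[OF finite_below[OF mu(1) nu(1)]])
    moreover have "?C mu nu = jtdet rfact (L1 + L2) (gam L1 L2 mu nu)"
      by (rule coeff_jtdet_nHe_top) (use sum_gam[OF mu(2) nu(2) assms(5)] in \<open>simp add: True c_def\<close>)
    ultimately show ?thesis by simp
  next
    case False
    let ?n = "real (c + 2 * ?N) - real d"
    \<comment> \<open>Summands outside the smaller index set carry a zero chain number, so every sum
      may run over \<open>below mu nu\<close>.\<close>
    have vanish: "T m n ab = 0" if "ab \<notin> below m n" "is_partition m" "is_partition n" "ab \<in> below mu nu" for m n ab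
      using F2skew_zero[of m n "fst ab" "snd ab"] that by (auto simp: T_def below_def split: prod.splits)
    have rec1: "?C m nu = (\<Sum>ab\<in>below mu nu. T m nu ab)" if "m \<in> lower_covers mu" for m
    proof -
      note m = lower_coverE[OF that] psize_lower_cover[OF that]
      have "?C m nu = (\<Sum>ab\<in>below m nu. T m nu ab)"
        unfolding T_def c_def by (rule less.hyps) (use m nu mu length_le_of_subset[OF m(1) mu(1) m(2)] in auto)
      also have "\<dots> = (\<Sum>ab\<in>below mu nu. T m nu ab)"
        by (rule sum.mono_neutral_left) (use below_lower_cover(1)[OF that] vanish[OF _ m(1) nu(1)] in auto)
      finally show ?thesis .
    qed
    have rec2: "?C mu n = (\<Sum>ab\<in>below mu nu. T mu n ab)" if "n \<in> lower_covers nu" for n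
    proof -
      note n = lower_coverE[OF that] psize_lower_cover[OF that]
      have "?C mu n = (\<Sum>ab\<in>below mu n. T mu n ab)"
        unfolding T_def c_def by (rule less.hyps) (use n nu mu length_le_of_subset[OF n(1) nu(1) n(2)] in auto)
      also have "\<dots> = (\<Sum>ab\<in>below mu nu. T mu n ab)"
        by (rule sum.mono_neutral_left) (use below_lower_cover(2)[OF that] vanish[OF _ mu(1) n(1)] in auto)
      finally show ?thesis .
    qed
    have pointwise: "(\<Sum>m\<in>lower_covers mu. T m nu ab) + (\<Sum>n\<in>lower_covers nu. T mu n ab) = - ?n * T mu nu ab"
      if ab: "ab \<in> below mu nu" for ab
    proof (cases "d = c + 2 * (psize (fst ab) + psize (snd ab))")
      case d: True
      obtain a b where ab_eq: "ab = (a, b)" by fastforce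
      have sub: "is_partition a" "is_partition b" "cells a \<subseteq> cells mu" "cells b \<subseteq> cells nu"
        using ab by (auto simp: below_def ab_eq)
      have ne: "(a, b) \<noteq> (mu, nu)" using d False by (auto simp: ab_eq)
      define j where "j = ?N - (psize a + psize b) - 1"
      \<comment> \<open>In the degree belonging to \<open>(a, b)\<close> the factor is
        \<open>2 * Suc j\<close>. Passing from \<open>j\<close> to \<open>Suc j\<close> in
        \<open>(- 1 / 2) ^ j / fact j\<close> divides by exactly its negative.\<close>
      have j: "?N - (psize a + psize b) = Suc j" "?n = 2 * real (Suc j)"
        using size[of a b] ab ne d by (auto simp: j_def ab_eq of_nat_diff)
      define E where "E = (- 1 / 2) ^ j / fact j * jtdet rfact (L1 + L2) (gam L1 L2 a b)"
      have T1: "T m nu ab = E * real (F2skew m nu a b)" if "m \<in> lower_covers mu" for m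
      proof -
        have "psize m + psize nu - (psize a + psize b) = j"
          using psize_lower_cover[OF that] by (simp add: j_def)
        thus ?thesis using d by (simp add: T_def ab_eq E_def mult_ac)
      qed
      have T2: "T mu n ab = E * real (F2skew mu n a b)" if "n \<in> lower_covers nu" for n
      proof -
        have "psize mu + psize n - (psize a + psize b) = j"
          using psize_lower_cover[OF that] by (simp add: j_def)
        thus ?thesis using d by (simp add: T_def ab_eq E_def mult_ac)
      qed
      have "(\<Sum>m\<in>lower_covers mu. T m nu ab) + (\<Sum>n\<in>lower_covers nu. T mu n ab) = E * real (F2skew mu nu a b)"
        unfolding F2skew_rec[OF mu(1) nu(1) sub(1,2,3,4) ne]
        by (simp add: T1 T2 sum_distrib_left distrib_left)
      also have "\<dots> = - ?n * T mu nu ab"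
      proof -
        have "T mu nu ab = (- 1 / 2) ^ Suc j / fact (Suc j) * real (F2skew mu nu a b) * jtdet rfact (L1 + L2) (gam L1 L2 a b)"
          using d unfolding T_def ab_eq prod.case j(1) fst_conv snd_conv
          by (simp only: simp_thms if_True)
        moreover have "fact (Suc j) = real (Suc j) * fact j" by simp
        ultimately show ?thesis unfolding j(2) E_def by (simp add: field_simps del: fact_Suc of_nat_Suc)
      qed
      finally show ?thesis .
    qed (auto simp: T_def split: prod.splits)
    have "?n * ?C mu nu = - ((\<Sum>m\<in>lower_covers mu. ?C m nu) + (\<Sum>n\<in>lower_covers nu. ?C mu n))"
      using coeff_jtdet_nHe_rec[where f = "gam L1 L2 mu nu" and L = "L1 + L2" and m = d]
      unfolding sum_moves_gam[OF mu nu] sum_gam[OF mu(2) nu(2) assms(5)] by (simp add: c_def)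
    also have "\<dots> = - (\<Sum>ab\<in>below mu nu. (\<Sum>m\<in>lower_covers mu. T m nu ab) + (\<Sum>n\<in>lower_covers nu. T mu n ab))"
      by (simp add: rec1 rec2 sum.distrib sum.swap[of _ "below mu nu"])
    also have "\<dots> = ?n * (\<Sum>ab\<in>below mu nu. T mu nu ab)"
      unfolding sum_distrib_left sum_negf[symmetric]
      by (intro sum.cong refl) (simp only: pointwise mult_minus_left minus_minus)
    finally show ?thesis using False by (simp only: mult_cancel_left) linarith
  qed
  thus ?case unfolding T_def c_def .
qed

section \<open>Hook products\<close>

definition gaps :: "int set \<Rightarrow> int \<Rightarrow> int set" where
  "gaps B n = {m. 0 \<le> m \<and> m < n \<and> m \<notin> B}"

text \<open>For a set of beta numbers, the hook lengths in the row of \<open>n\<close> are the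
  differences from \<open>n\<close> to the gaps below it. Working with sets makes the product
  insensitive to row order, and \<open>P\<close> selects hooks by parity.\<close>

definition hookprod :: "(int \<Rightarrow> bool) \<Rightarrow> int set \<Rightarrow> real" where
  "hookprod P B = (\<Prod>n\<in>B. \<Prod>m\<in>gaps B n. if P (n - m) then of_int (n - m) else 1)"

abbreviation betas :: "nat \<Rightarrow> nat list \<Rightarrow> int set" where
  "betas L lam \<equiv> beta L lam ` {..<L}"

lemma finite_gaps [simp]: "finite (gaps B n)"
  by (rule finite_subset[of _ "{0..<n}"]) (auto simp: gaps_def)

lemma hookprod_pos: "hookprod P B > 0"
  unfolding hookprod_def by (intro prod_pos) (auto simp: gaps_def)

lemma hookprod_parity: "hookprod (\<lambda>_. True) B = hookprod odd B * hookprod even B"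
  unfolding hookprod_def prod.distrib[symmetric] by (intro prod.cong) auto

lemma prod_below_eq_fact:
  assumes "0 \<le> n"
  shows "(\<Prod>m\<in>{0..<n}. real_of_int (n - m)) = fact (nat n)"
proof -
  have "(\<Prod>m\<in>{0..<n}. real_of_int (n - m)) = (\<Prod>i\<in>{1..nat n}. real i)"
    by (rule prod.reindex_bij_witness[of _ "\<lambda>i. n - int i" "\<lambda>m. nat (n - m)"]) (use assms in auto)
  thus ?thesis by (simp add: fact_prod)
qed

lemma prod_ordered_pairs:
  fixes f :: "nat \<Rightarrow> int"
  assumes "inj_on f {..<L}"
  shows "(\<Prod>i<L. \<Prod>i'<L. if f i' < f i then real_of_int (f i - f i') else 1) =
    (\<Prod>i<L. \<Prod>i'<i. \<bar>real_of_int (f i - f i')\<bar>)"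
  using assms
proof (induction L)
  case (Suc L)
  have "(\<Prod>i<Suc L. \<Prod>i'<Suc L. if f i' < f i then real_of_int (f i - f i') else 1) =
    (\<Prod>i<L. \<Prod>i'<L. if f i' < f i then real_of_int (f i - f i') else 1) *
    ((\<Prod>i<L. if f L < f i then real_of_int (f i - f L) else 1) * (\<Prod>i<L. if f i < f L then real_of_int (f L - f i) else 1))"
    by (simp add: prod.distrib mult_ac)
  also have "(\<Prod>i<L. if f L < f i then real_of_int (f i - f L) else 1) * (\<Prod>i<L. if f i < f L then real_of_int (f L - f i) else 1)
     = (\<Prod>i<L. \<bar>real_of_int (f L - f i)\<bar>)"
    unfolding prod.distrib[symmetric]
  proof (intro prod.cong refl)
    fix i assume "i \<in> {..<L}"
    hence "f i \<noteq> f L" using Suc.prems by (auto simp: inj_on_def)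
    thus "(if f L < f i then real_of_int (f i - f L) else 1) * (if f i < f L then real_of_int (f L - f i) else 1)
      = \<bar>real_of_int (f L - f i)\<bar>" by auto
  qed
  finally show ?case using Suc by (simp add: inj_on_def)
qed simp

text \<open>The sign of the Vandermonde product of \<open>f\<close>, for pairwise distinct
  values.\<close>

definition vsign :: "nat \<Rightarrow> (nat \<Rightarrow> int) \<Rightarrow> real" where
  "vsign L f = (\<Prod>i<L. \<Prod>i'<i. of_int (sgn (f i - f i')))"

lemma inj_on_less_neq: "inj_on f {..<L} \<Longrightarrow> i < L \<Longrightarrow> i' < i \<Longrightarrow> f i \<noteq> f i'" for i :: nat
  by (metis inj_onD lessThan_iff less_irrefl less_trans)

text \<open>Each \<open>n!\<close> is the product of \<open>n - m\<close> over all \<open>m\<close>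
  below \<open>n\<close>. The gaps give the hooks of the row, the occupied positions give absolute
  Vandermonde factors, and these cancel up to sign.\<close>

lemma jtdet_rfact_hookprod:
  assumes inj: "inj_on f {..<L}" and nn: "\<And>i. i < L \<Longrightarrow> 0 \<le> f i"
  shows "jtdet rfact L f = vsign L f / hookprod (\<lambda>_. True) (f ` {..<L})"
proof -
  let ?B = "f ` {..<L}" and ?H = "hookprod (\<lambda>_. True) (f ` {..<L})"
  let ?A = "\<Prod>i<L. \<Prod>i'<i. \<bar>real_of_int (f i - f i')\<bar>"
  have "(\<Prod>i<L. fact (nat (f i))) = (\<Prod>n\<in>?B. \<Prod>m\<in>{0..<n}. real_of_int (n - m))"
    unfolding prod.reindex[OF inj] o_def using nn by (intro prod.cong refl) (simp only: lessThan_iff prod_below_eq_fact)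
  also have "\<dots> = (\<Prod>n\<in>?B. (\<Prod>m\<in>gaps ?B n. real_of_int (n - m)) * (\<Prod>m\<in>?B. if m < n then real_of_int (n - m) else 1))"
  proof (intro prod.cong refl)
    fix n assume "n \<in> ?B"
    have "{0..<n} = gaps ?B n \<union> {m\<in>?B. m < n}"
      using nn by (auto simp: gaps_def)
    moreover have "gaps ?B n \<inter> {m\<in>?B. m < n} = {}" by (auto simp: gaps_def)
    ultimately have "(\<Prod>m\<in>{0..<n}. real_of_int (n - m)) = (\<Prod>m\<in>gaps ?B n. real_of_int (n - m)) * (\<Prod>m\<in>{m\<in>?B. m < n}. real_of_int (n - m))"
      by (simp add: prod.union_disjoint)
    also have "(\<Prod>m\<in>{m\<in>?B. m < n}. real_of_int (n - m)) = (\<Prod>m\<in>?B. if m < n then real_of_int (n - m) else 1)"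
      by (rule prod.inter_filter) simp
    finally show "(\<Prod>m\<in>{0..<n}. real_of_int (n - m)) = (\<Prod>m\<in>gaps ?B n. real_of_int (n - m)) * (\<Prod>m\<in>?B. if m < n then real_of_int (n - m) else 1)" .
  qed
  also have "\<dots> = ?H * (\<Prod>i<L. \<Prod>i'<L. if f i' < f i then real_of_int (f i - f i') else 1)"
    unfolding hookprod_def prod.distrib by (simp add: prod.reindex[OF inj])
  also have "\<dots> = ?H * ?A" unfolding prod_ordered_pairs[OF inj] ..
  finally have "?H * ?A * jtdet rfact L f = (\<Prod>i<L. \<Prod>i'<i. of_int (f i - f i'))"
    using jtdet_rfact_vandermonde[of L f] nn by simp
  also have "\<dots> = ?A * vsign L f"
    unfolding vsign_def prod.distrib[symmetric] by (intro prod.cong refl) (simp add: sgn_if abs_if)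
  finally have "?A * (?H * jtdet rfact L f) = ?A * vsign L f" by (simp add: mult_ac)
  moreover have "?A \<noteq> 0" using inj_on_less_neq[OF inj] by auto
  ultimately have "?H * jtdet rfact L f = vsign L f" by simp
  thus ?thesis using hookprod_pos[of "\<lambda>_. True" ?B] by (simp add: field_simps)
qed

lemma vsign_square: "inj_on f {..<L} \<Longrightarrow> vsign L f * vsign L f = 1"
  unfolding vsign_def prod.distrib[symmetric]
  by (intro prod.neutral ballI) (auto simp: sgn_if dest: inj_on_less_neq)

text \<open>Of the \<open>beta L lam i\<close> nonnegative numbers below this beta number, exactly
  the \<open>L - Suc i\<close> later beta numbers are occupied.\<close>

lemma card_gaps_betas:
  assumes "is_partition lam" "i < L"
  shows "card (gaps (betas L lam) (beta L lam i)) = part lam i"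
proof -
  have eq: "gaps (betas L lam) (beta L lam i) = {0..<beta L lam i} - beta L lam ` {i<..<L}"
  proof -
    have "i < i'" if "beta L lam i' < beta L lam i" for i'
      using beta_less[OF assms(1), of i' i L] that by (cases i i' rule: linorder_cases) auto
    thus ?thesis by (auto simp: gaps_def)
  qed
  have "beta L lam ` {i<..<L} \<subseteq> {0..<beta L lam i}"
    using beta_less[OF assms(1)] beta_nonneg by auto
  hence "card (gaps (betas L lam) (beta L lam i)) = nat (beta L lam i) - (L - Suc i)"
    unfolding eq using card_image[OF inj_on_subset[OF beta_inj[OF assms(1)] subset_UNIV], of L "{i<..<L}"]
    by (subst card_Diff_subset) auto
  thus ?thesis using assms(2) by (auto simp: beta_def)
qed

text \<open>The hook length formula.\<close>

lemma fact_eq_Fskew_hookprod: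
  assumes "is_partition mu" "length mu \<le> L"
  shows "real (Fskew mu []) * hookprod (\<lambda>_. True) (betas L mu) = fact (psize mu)"
proof -
  \<comment> \<open>Both sides satisfy the same recursion over lower covers: chains by their last
    step, determinants by \<open>jtdet_rfact_rec\<close>, whose weight is here the size of
    \<open>mu\<close>.\<close>
  have D: "real (Fskew mu []) * jtdet rfact L (beta L []) = fact (psize mu) * jtdet rfact L (beta L mu)"
    using assms
  proof (induction "psize mu" arbitrary: mu rule: less_induct)
    case less
    show ?case
    proof (cases "mu = []")
      case True
      thus ?thesis by (simp add: Fskew_self psize_def)
    next
      case False
      have "cells m \<subseteq> cells mu" "psize mu = Suc (psize m)" "length m \<le> L" "is_partition m" if "m \<in> lower_covers mu" for m
        using that less.prems lower_coverE[OF that] psize_lower_cover[OF that] length_le_of_subset[of m mu] by auto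
      note m = this
      have "psize mu \<noteq> 0"
        using False less.prems by (cases mu) (auto simp: psize_def is_partition_def)
      hence f: "fact (psize mu) = real (psize mu) * fact (psize mu - 1)"
        by (simp add: fact_reduce)
      have "real (Fskew mu []) * jtdet rfact L (beta L []) = (\<Sum>m\<in>lower_covers mu. real (Fskew m []) * jtdet rfact L (beta L []))"
        unfolding Fskew_rec[OF less.prems(1) False] by (simp add: sum_distrib_right)
      also have "\<dots> = (\<Sum>m\<in>lower_covers mu. fact (psize mu - 1) * jtdet rfact L (beta L m))"
        using m by (intro sum.cong refl) (subst less.hyps, auto)
      also have "\<dots> = fact (psize mu - 1) * (\<Sum>i<L. jtdet rfact L ((beta L mu)(i := beta L mu i - 1)))"
        unfolding sum_distrib_left[symmetric]
        by (subst sum_lower_covers[OF less.prems]) (auto intro: jtdet_neg rfact_neg jtdet_repeat)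
      also have "\<dots> = fact (psize mu) * jtdet rfact L (beta L mu)"
        unfolding jtdet_rfact_rec[symmetric] sum_beta[OF less.prems(2)] f by simp
      finally show ?thesis .
    qed
  qed
  have inj: "inj_on (beta L lam) {..<L}" if "is_partition lam" for lam
    using beta_inj[OF that] by (rule inj_on_subset) simp
  have "sgn (beta L lam i - beta L lam i') = - 1" if "is_partition lam" "i' < i" for lam i i'
    using beta_less[OF that, of L] by simp
  \<comment> \<open>Beta numbers of any partition decrease, so this sign depends on \<open>L\<close>
    only and cancels.\<close>
  hence sgn: "vsign L (beta L mu) = vsign L (beta L [])"
    unfolding vsign_def using assms(1) by (intro prod.cong refl) simp
  have "gaps (betas L []) (beta L [] i) = {}" if "i < L" for i
    using card_gaps_betas[of "[]" i L] that by simp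
  hence H0: "hookprod (\<lambda>_. True) (betas L []) = 1"
    unfolding hookprod_def by (intro prod.neutral) auto
  have "vsign L (beta L []) \<noteq> 0" using vsign_square[OF inj[of "[]"]] by auto
  moreover have "jtdet rfact L (beta L lam) = vsign L (beta L lam) / hookprod (\<lambda>_. True) (betas L lam)"
    if "is_partition lam" for lam
    by (rule jtdet_rfact_hookprod[OF inj[OF that]]) (rule beta_nonneg)
  ultimately show ?thesis
    using D hookprod_pos[of "\<lambda>_. True" "betas L mu"] assms(1) by (simp add: sgn H0 field_simps)
qed

lemma down_closed_eq_lessThan:
  fixes C :: "nat set"
  assumes "finite C" and down: "\<And>i i'. i \<in> C \<Longrightarrow> i' \<le> i \<Longrightarrow> i' \<in> C"
  shows "C = {..<card C}"
proof (cases "C = {}")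
  case False
  have "C = {..Max C}"
    using Max_in[OF assms(1) False] Max_ge[OF assms(1)] down by blast
  hence C: "C = {..<Suc (Max C)}" by (simp only: lessThan_Suc_atMost)
  hence "card C = Suc (Max C)" by (metis card_lessThan)
  with C show ?thesis by simp
qed simp

lemma column_eq:
  assumes "is_partition lam"
  shows "{i'. i' < length lam \<and> j < lam ! i'} = {..<card {i'. i' < length lam \<and> j < lam ! i'}}"
proof (rule down_closed_eq_lessThan)
  have C: "{i'. i' < length lam \<and> j < lam ! i'} = {i. j < part lam i}" by (auto simp: part_def)
  show "i' \<in> {i'. i' < length lam \<and> j < lam ! i'}" if "i \<in> {i'. i' < length lam \<and> j < lam ! i'}" "i' \<le> i" for i i'
    using that part_antimono[OF assms that(2)] unfolding C by auto
qed simp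

text \<open>Connects hooks defined by arm and leg with differences of beta numbers: the cells of a
  row correspond to the gaps below its beta number. Injectivity and a count replace a direct proof
  of surjectivity.\<close>

lemma Hodd_hookprod:
  assumes lam: "is_partition lam" and L: "length lam \<le> L"
  shows "real (Hodd lam) = hookprod odd (betas L lam)"
proof -
  let ?B = "betas L lam"
  define col where "col j = card {i'. i' < length lam \<and> j < lam ! i'}" for j
  have col: "i < col j \<longleftrightarrow> j < part lam i" for i j
    using column_eq[OF lam, of j] unfolding col_def[symmetric] by (auto simp: set_eq_iff part_def)
  have col_L: "col j \<le> L" for j
    using col[of "length lam" j] L by (simp add: part_beyond)
  have hook: "hook lam (i, j) = (part lam i - j) + col j - Suc i" if "j < part lam i" for i j
    using that by (simp add: hook_def col_def part_def split: if_splits)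
  \<comment> \<open>This is the gap attached to column \<open>j\<close>, obtained by solving
    \<open>hook lam (i, j) = beta L lam i - e j\<close>; the row index drops out.\<close>
  define e where "e j = int L + int j - int (col j)" for j
  have hook_e: "int (hook lam (i, j)) = beta L lam i - e j" if "j < part lam i" for i j
    using that col[of i j] hook[OF that] by (simp add: e_def beta_def)
  have e_less: "e j < e j'" if "j < j'" for j j'
  proof -
    have "col j' \<le> col j"
      using col[of "col j" j'] col[of "col j" j] that by (simp add: not_less[symmetric])
    thus ?thesis using that by (simp add: e_def)
  qed
  have bij: "bij_betw e {..<part lam i} (gaps ?B (beta L lam i))" if i: "i < L" for i
  proof -
    have inj: "inj_on e {..<part lam i}"
      by (rule inj_onI) (metis e_less less_irrefl linorder_neqE_nat)
    have "e j \<in> gaps ?B (beta L lam i)" if j: "j < part lam i" for j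
    proof -
      have "e j \<noteq> beta L lam i'" for i'
        using col[of i' j] by (cases "i' < col j") (auto simp: e_def beta_def)
      moreover have "0 \<le> e j" using col_L[of j] by (simp add: e_def)
      moreover have "0 < hook lam (i, j)" using hook[OF j] col[of i j] j by simp
      ultimately show ?thesis using hook_e[OF j] by (auto simp: gaps_def)
    qed
    hence "e ` {..<part lam i} \<subseteq> gaps ?B (beta L lam i)" by auto
    moreover have "card (e ` {..<part lam i}) = card (gaps ?B (beta L lam i))"
      using card_gaps_betas[OF lam i] inj by (simp add: card_image)
    ultimately have "e ` {..<part lam i} = gaps ?B (beta L lam i)"
      by (intro card_subset_eq) auto
    thus ?thesis using inj by (simp add: bij_betw_def)
  qed
  have "real (Hodd lam) = (\<Prod>c\<in>cells lam. if odd (hook lam c) then real (hook lam c) else 1)"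
    unfolding Hodd_def of_nat_prod by (rule prod.inter_filter) simp
  also have "cells lam = (SIGMA i:{..<L}. {..<part lam i})"
    using L by (auto simp: cells_def part_def split: if_splits)
  also have "(\<Prod>c\<in>(SIGMA i:{..<L}. {..<part lam i}). if odd (hook lam c) then real (hook lam c) else 1)
    = (\<Prod>i<L. \<Prod>j<part lam i. if odd (hook lam (i, j)) then real (hook lam (i, j)) else 1)"
    by (subst prod.Sigma) (simp_all add: split_def cong: if_cong)
  also have "\<dots> = (\<Prod>i<L. \<Prod>m\<in>gaps ?B (beta L lam i). if odd (beta L lam i - m) then of_int (beta L lam i - m) else 1)"
  proof (intro prod.cong refl)
    fix i assume "i \<in> {..<L}"
    hence i: "i < L" by simp
    have "(\<Prod>m\<in>gaps ?B (beta L lam i). if odd (beta L lam i - m) then real_of_int (beta L lam i - m) else 1)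
      = (\<Prod>j<part lam i. if odd (beta L lam i - e j) then real_of_int (beta L lam i - e j) else 1)"
      by (rule prod.reindex_bij_betw[OF bij[OF i], symmetric])
    also have "\<dots> = (\<Prod>j<part lam i. if odd (hook lam (i, j)) then real (hook lam (i, j)) else 1)"
      by (intro prod.cong refl) (simp only: lessThan_iff hook_e[symmetric] even_of_nat of_int_of_nat_eq)
    finally show "(\<Prod>j<part lam i. if odd (hook lam (i, j)) then real (hook lam (i, j)) else 1)
      = (\<Prod>m\<in>gaps ?B (beta L lam i). if odd (beta L lam i - m) then of_int (beta L lam i - m) else 1)" ..
  qed
  also have "\<dots> = hookprod odd ?B"
    unfolding hookprod_def using beta_inj[OF lam] by (subst prod.reindex) (auto intro: inj_on_subset)
  finally show ?thesis .
qed

section \<open>Interleaving two sets of beta numbers\<close>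

definition weave :: "int set \<Rightarrow> int set \<Rightarrow> int set" where
  "weave A B = (\<lambda>n. 2 * n) ` A \<union> (\<lambda>n. 2 * n + 1) ` B"

lemma gam_image: "gam L1 L2 mu nu ` {..<L1 + L2} = weave (betas L1 mu) (betas L2 nu)"
proof -
  have "{..<L1 + L2} = {..<L1} \<union> (+) L1 ` {..<L2}"
    by (auto simp: lessThan_atLeast0 image_add_atLeastLessThan)
  moreover have "gam L1 L2 mu nu ` {..<L1} = (\<lambda>n. 2 * n) ` betas L1 mu"
    by (force simp: gam_def image_image)
  moreover have "gam L1 L2 mu nu ` (+) L1 ` {..<L2} = (\<lambda>n. 2 * n + 1) ` betas L2 nu"
    unfolding image_image by (rule image_cong) (simp_all add: gam_def)
  ultimately show ?thesis by (simp only: weave_def image_Un)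
qed

text \<open>An even difference joins two positions of the same parity class, where it is twice a
  difference within \<open>A\<close> or within \<open>B\<close>. There is one factor 2 for each such
  hook.\<close>

lemma hookprod_even_weave:
  assumes "finite A" "finite B"
  shows "hookprod even (weave A B) = 2 ^ ((\<Sum>n\<in>A. card (gaps A n)) + (\<Sum>n\<in>B. card (gaps B n)))
    * hookprod (\<lambda>_. True) A * hookprod (\<lambda>_. True) B"
proof -
  let ?W = "weave A B"
  have row: "(\<Prod>m\<in>gaps ?W (2 * n + d). if even (2 * n + d - m) then real_of_int (2 * n + d - m) else 1) =
      2 ^ card (gaps C n) * (\<Prod>m\<in>gaps C n. real_of_int (n - m))"
    if d: "d = 0 \<and> C = A \<or> d = 1 \<and> C = B" for n d C
  proof -
    have "(\<lambda>m. 2 * m + d) ` gaps C n = {m \<in> gaps ?W (2 * n + d). even (2 * n + d - m)}" (is "?l = ?r")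
    proof
      show "?l \<subseteq> ?r" using d by (auto simp: gaps_def weave_def) presburger+
      show "?r \<subseteq> ?l"
      proof
        fix m assume m: "m \<in> ?r"
        hence "even (m - d)" using d by auto
        then obtain m' where m': "m = 2 * m' + d" by (metis diff_add_cancel evenE)
        moreover have "m' \<in> gaps C n" using m d unfolding m' by (auto simp: gaps_def weave_def)
        ultimately show "m \<in> ?l" by blast
      qed
    qed
    hence "(\<Prod>m\<in>gaps ?W (2 * n + d). if even (2 * n + d - m) then real_of_int (2 * n + d - m) else 1) =
      (\<Prod>m\<in>(\<lambda>m. 2 * m + d) ` gaps C n. real_of_int (2 * n + d - m))"
      by (simp only: prod.inter_filter finite_gaps)
    also have "\<dots> = (\<Prod>m\<in>gaps C n. 2 * real_of_int (n - m))"
      by (subst prod.reindex) (auto simp: inj_on_def algebra_simps)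
    finally show ?thesis by (simp only: prod.distrib prod_constant)
  qed
  let ?h = "\<lambda>n. \<Prod>m\<in>gaps ?W n. if even (n - m) then real_of_int (n - m) else 1"
  have "hookprod even ?W = (\<Prod>n\<in>(\<lambda>n. 2 * n) ` A. ?h n) * (\<Prod>n\<in>(\<lambda>n. 2 * n + 1) ` B. ?h n)"
    unfolding hookprod_def weave_def[of A B]
    by (rule prod.union_disjoint) (use assms in \<open>auto, presburger\<close>)
  also have "(\<Prod>n\<in>(\<lambda>n. 2 * n) ` A. ?h n) = (\<Prod>n\<in>A. ?h (2 * n))"
    by (subst prod.reindex) (auto simp: inj_on_def)
  also have "\<dots> = (\<Prod>n\<in>A. 2 ^ card (gaps A n) * (\<Prod>m\<in>gaps A n. real_of_int (n - m)))"
    using row[of 0 A] by (intro prod.cong refl) (simp only: add_0_right simp_thms)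
  also have "(\<Prod>n\<in>(\<lambda>n. 2 * n + 1) ` B. ?h n) = (\<Prod>n\<in>B. ?h (2 * n + 1))"
    by (subst prod.reindex) (auto simp: inj_on_def)
  also have "\<dots> = (\<Prod>n\<in>B. 2 ^ card (gaps B n) * (\<Prod>m\<in>gaps B n. real_of_int (n - m)))"
    using row[of 1 B] by (intro prod.cong refl) (simp only: simp_thms)
  finally show ?thesis
    unfolding hookprod_def by (simp add: prod.distrib power_add power_sum)
qed

lemma sum_card_gaps:
  assumes "is_partition lam" "length lam \<le> L"
  shows "(\<Sum>n\<in>betas L lam. card (gaps (betas L lam) n)) = psize lam"
proof -
  have "(\<Sum>n\<in>betas L lam. card (gaps (betas L lam) n)) = (\<Sum>i<L. card (gaps (betas L lam) (beta L lam i)))"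
    using beta_inj[OF assms(1)] by (subst sum.reindex) (auto intro: inj_on_subset)
  thus ?thesis using assms by (simp add: card_gaps_betas psize_part)
qed

section \<open>Maya diagrams\<close>

definition maya_beta :: "nat \<Rightarrow> nat list \<Rightarrow> int set" where
  "maya_beta L lam = {n. n < 0} \<union> betas L lam"

text \<open>The new zero row has beta number 0 and raises all others by one, so padding is a
  translation of the Maya diagram.\<close>

lemma maya_beta_Suc:
  assumes "length lam \<le> L"
  shows "maya_beta (Suc L) lam = (\<lambda>m. m + 1) ` maya_beta L lam"
proof -
  have "betas (Suc L) lam = insert 0 ((\<lambda>m. m + 1) ` betas L lam)"
    using part_beyond[OF assms] by (simp add: lessThan_Suc beta_def image_image algebra_simps)
  moreover have "insert 0 {n. n < 0} = (\<lambda>m. m + 1) ` {n. n < (0::int)}"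
    by (auto simp: image_iff) presburger+
  ultimately show ?thesis by (auto simp: maya_beta_def image_Un)
qed

lemma maya_beta_shift:
  assumes "length lam \<le> L"
  shows "maya_beta (L + t) lam = (\<lambda>m. m + int t) ` maya_beta L lam"
proof (induction t)
  case (Suc t)
  thus ?case using assms maya_beta_Suc[of lam "L + t"] by (simp add: image_image algebra_simps)
qed simp

lemma betas_nonneg: "n \<in> betas L lam \<Longrightarrow> 0 \<le> n"
  by (auto intro: beta_nonneg)

lemma maya_beta_eqD:
  assumes "maya_beta L lam = {n. n < 0} \<union> S" "\<And>n. n \<in> S \<Longrightarrow> 0 \<le> n"
  shows "betas L lam = S"
proof -
  have "betas L lam = {n \<in> maya_beta L lam. 0 \<le> n}"
    using betas_nonneg[of _ L lam] unfolding maya_beta_def by fastforce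
  also have "\<dots> = S" unfolding assms(1) using assms(2) by fastforce
  finally show ?thesis .
qed

lemma maya_of_eq: "maya_of lam = maya_beta (length lam) lam"
proof -
  have "int ` set (degvec lam) = betas (length lam) lam"
    unfolding degvec_def set_map image_image set_upt lessThan_atLeast0
    by (rule image_cong) (auto simp: beta_def part_def of_nat_diff)
  thus ?thesis by (simp add: maya_of_def maya_beta_def)
qed

lemma sort_partition: "is_partition lam \<Longrightarrow> sort lam = rev lam"
  by (rule properties_for_sort) (auto simp: is_partition_def sorted_wrt_rev)

text \<open>The empty positions below a beta number count its part. Negative positions and padding
  rows have count zero and are filtered out, so the padding leaves no trace.\<close>

lemma maya_part_beta:
  assumes lam: "is_partition lam" and L: "length lam \<le> L"
  shows "maya_part (maya_beta L lam) = lam"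
proof -
  let ?M = "maya_beta L lam"
  have cnt: "maya_cnt ?M (beta L lam i) = part lam i" if "i < L" for i
  proof -
    have "{n. n \<notin> ?M \<and> n < beta L lam i} = gaps (betas L lam) (beta L lam i)"
      by (auto simp: maya_beta_def gaps_def)
    thus ?thesis using card_gaps_betas[OF lam that] by (simp add: maya_cnt_def)
  qed
  have neg: "maya_cnt ?M m = 0" if "m < 0" for m
  proof -
    have "{n. n \<notin> ?M \<and> n < m} = {}" using that by (auto simp: maya_beta_def)
    thus ?thesis by (simp only: maya_cnt_def card.empty)
  qed
  have "{m \<in> ?M. 0 < maya_cnt ?M m} = beta L lam ` {..<length lam}"
  proof (intro equalityI subsetI)
    fix m assume m: "m \<in> {m \<in> ?M. 0 < maya_cnt ?M m}"
    hence "\<not> m < 0" using neg[of m] by auto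
    then obtain i where i: "i < L" "m = beta L lam i" using m by (auto simp: maya_beta_def)
    hence "0 < part lam i" using cnt m by simp
    thus "m \<in> beta L lam ` {..<length lam}" using i part_pos_iff[OF lam] by auto
  next
    fix m assume "m \<in> beta L lam ` {..<length lam}"
    thus "m \<in> {m \<in> ?M. 0 < maya_cnt ?M m}"
      using cnt part_pos_iff[OF lam] L by (auto simp: maya_beta_def)
  qed
  moreover have "inj_on (beta L lam) {..<length lam}"
    using beta_inj[OF lam] by (rule inj_on_subset) simp
  ultimately have "image_mset (maya_cnt ?M) (mset_set {m \<in> ?M. 0 < maya_cnt ?M m})
      = image_mset (\<lambda>i. maya_cnt ?M (beta L lam i)) (mset_set {..<length lam})"
    by (simp add: image_mset_mset_set[symmetric] image_mset.compositionality o_def)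
  also have "\<dots> = image_mset (\<lambda>i. lam ! i) (mset_set {..<length lam})"
    using cnt L by (intro image_mset_cong) (simp add: part_def)
  also have "\<dots> = mset (map (\<lambda>i. lam ! i) [0..<length lam])"
    by (simp add: lessThan_atLeast0)
  also have "\<dots> = mset lam" by (simp only: map_nth)
  finally show ?thesis
    unfolding maya_part_def using sort_partition[OF lam] by simp
qed

lemma betas_inject:
  assumes "is_partition a" "length a \<le> L" "is_partition b" "length b \<le> L" "betas L a = betas L b"
  shows "a = b"
  using maya_part_beta[of a L] maya_part_beta[of b L] assms by (simp add: maya_beta_def)

lemma partition_of_betas:
  fixes S :: "int set"
  assumes fin: "finite S" and nn: "\<And>n. n \<in> S \<Longrightarrow> 0 \<le> n"
  obtains lam where "is_partition lam" "length lam \<le> card S" "betas (card S) lam = S"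
proof -
  define L where "L = card S"
  define xs where "xs = sorted_list_of_set S"
  have xs: "length xs = L" "set xs = S" and st: "sorted_wrt (<) xs"
    using fin by (simp_all add: xs_def L_def)
  have step: "xs ! i < xs ! Suc i" if "Suc i < L" for i
    using st that xs(1) by (simp add: sorted_wrt_iff_nth_less)
  have low: "int i \<le> xs ! i" if "i < L" for i
    using that
  proof (induction i)
    case 0
    have "xs ! 0 \<in> S" using 0 xs nth_mem by metis
    thus ?case using nn by simp
  next
    case (Suc i)
    thus ?case using step[of i] by simp
  qed
  \<comment> \<open>Subtracts the staircase from the increasing list, read from its largest entry.
    By \<open>low\<close> the conversion to \<open>nat\<close> truncates nothing.\<close>
  define p where "p i = (if i < L then nat (xs ! (L - Suc i) - int (L - Suc i)) else 0)" for i
  have "p (Suc i) \<le> p i" for i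
  proof (cases "Suc i < L")
    case True
    hence "Suc (L - Suc (Suc i)) = L - Suc i" by simp
    with step[of "L - Suc (Suc i)"] True have "xs ! (L - Suc (Suc i)) < xs ! (L - Suc i)" by simp
    thus ?thesis using True by (simp add: p_def of_nat_diff)
  qed (simp add: p_def)
  moreover have "p L = 0" by (simp add: p_def)
  ultimately obtain lam where lam: "is_partition lam" "part lam = p" "length lam \<le> L"
    by (rule partition_exists)
  have beta: "beta L lam i = xs ! (L - Suc i)" if "i < L" for i
    using that low[of "L - Suc i"] by (simp add: beta_def lam(2) p_def of_nat_diff)
  have "betas L lam = (\<lambda>i. xs ! (L - Suc i)) ` {..<L}"
    using beta by (rule image_cong[OF refl]) simp
  also have "\<dots> = (\<lambda>i. xs ! i) ` (\<lambda>i. L - Suc i) ` {..<L}" by (simp add: image_image)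
  also have "(\<lambda>i. L - Suc i) ` {..<L} = {..<L}"
  proof (intro equalityI subsetI)
    fix i assume "i \<in> {..<L}"
    thus "i \<in> (\<lambda>i. L - Suc i) ` {..<L}" by (intro image_eqI[of _ _ "L - Suc i"]) auto
  qed auto
  also have "(\<lambda>i. xs ! i) ` {..<L} = S"
    using xs by (auto simp: set_conv_nth)
  finally show ?thesis using that lam unfolding L_def by blast
qed

lemma weave_maya:
  "(\<lambda>m. 2 * m) ` maya_beta L1 mu \<union> (\<lambda>m. 2 * m + 1) ` maya_beta L2 nu
    = {n. n < 0} \<union> weave (betas L1 mu) (betas L2 nu)"
proof -
  have neg: "{n. n < 0} = (\<lambda>m. 2 * m) ` {n. n < (0::int)} \<union> (\<lambda>m. 2 * m + 1) ` {n. n < 0}"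
  proof (intro equalityI subsetI)
    fix n :: int assume n: "n \<in> {n. n < 0}"
    show "n \<in> (\<lambda>m. 2 * m) ` {n. n < (0::int)} \<union> (\<lambda>m. 2 * m + 1) ` {n. n < 0}"
    proof (cases "even n")
      case True
      then obtain m where "n = 2 * m" by blast
      thus ?thesis using n by auto
    next
      case False
      then obtain m where "n = 2 * m + 1" by (rule oddE)
      thus ?thesis using n by auto
    qed
  qed auto
  have "(\<lambda>m. 2 * m) ` maya_beta L1 mu \<union> (\<lambda>m. 2 * m + 1) ` maya_beta L2 nu =
    ((\<lambda>m. 2 * m) ` {n. n < 0} \<union> (\<lambda>m. 2 * m + 1) ` {n. n < 0}) \<union> weave (betas L1 mu) (betas L2 nu)"
    unfolding maya_beta_def weave_def image_Un by (simp only: Un_ac)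
  thus ?thesis by (simp only: neg[symmetric])
qed

lemma weave_nonneg: "n \<in> weave (betas L1 mu) (betas L2 nu) \<Longrightarrow> 0 \<le> n"
  by (auto simp: weave_def intro!: add_nonneg_nonneg beta_nonneg)

lemma gam_inj:
  assumes "is_partition mu" "is_partition nu"
  shows "inj_on (gam L1 L2 mu nu) {..<L1 + L2}"
proof (rule inj_onI)
  fix i j assume eq: "gam L1 L2 mu nu i = gam L1 L2 mu nu j"
  have par: "even (gam L1 L2 mu nu i) \<longleftrightarrow> i < L1" for i by (simp add: gam_def)
  show "i = j"
  proof (cases "i < L1")
    case True
    hence "j < L1" using par[of i] par[of j] unfolding eq by blast
    hence "beta L1 mu i = beta L1 mu j" using eq True by (simp add: gam_def)
    thus ?thesis by (rule injD[OF beta_inj[OF assms(1)]])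
  next
    case False
    hence j: "\<not> j < L1" using par[of i] par[of j] unfolding eq by blast
    hence "beta L2 nu (i - L1) = beta L2 nu (j - L1)" using eq False by (simp add: gam_def)
    hence "i - L1 = j - L1" by (rule injD[OF beta_inj[OF assms(2)]])
    thus ?thesis using False j by linarith
  qed
qed

lemma card_weave:
  assumes "is_partition mu" "is_partition nu"
  shows "card (weave (betas L1 mu) (betas L2 nu)) = L1 + L2"
  using card_image[OF gam_inj[OF assms, of L1 L2]] by (simp add: gam_image)

text \<open>Frees \<open>Phi\<close> from its particular choice of shifts: any paddings with
  difference \<open>k\<close> exceed the chosen ones by a common amount, which only translates the
  interleaved diagram.\<close>

lemma betas_Phi:
  assumes mu: "is_partition mu" "length mu \<le> L1" and nu: "is_partition nu" "length nu \<le> L2"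
    and k: "int L2 = int L1 + k"
  shows "is_partition (Phi mu nu k)" "length (Phi mu nu k) \<le> L1 + L2"
    "betas (L1 + L2) (Phi mu nu k) = weave (betas L1 mu) (betas L2 nu)"
proof -
  define d where "d = k + int (length mu) - int (length nu)"
  define s s' where "s = nat (max 0 (- d))" and "s' = nat (max 0 d)"
  define l1 l2 where "l1 = length mu + s" and "l2 = length nu + s'"
  have s: "max 0 (- d) = int s" "max 0 d = int s'" by (simp_all add: s_def s'_def)
  have l: "int l2 = int l1 + k" unfolding l1_def l2_def d_def s_def s'_def by simp
  \<comment> \<open>One of \<open>s\<close>, \<open>s'\<close> is zero, so \<open>l1\<close> or
    \<open>l2\<close> is an actual length; the common difference \<open>k\<close> transfers the
    bound.\<close>
  have "l1 \<le> L1" using mu(2) nu(2) k unfolding l1_def s_def d_def by linarith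
  then obtain t where t: "L1 = l1 + t" by (metis le_Suc_ex)
  hence t2: "L2 = l2 + t" using l k by linarith
  have "Phi mu nu k = maya_part ((\<lambda>m. 2 * m) ` maya_beta l1 mu \<union> (\<lambda>m. 2 * m + 1) ` maya_beta l2 nu)"
    unfolding Phi_def Let_def d_def[symmetric] s maya_shift_def maya_of_eq l1_def l2_def
    by (simp add: maya_beta_shift)
  hence Phi: "Phi mu nu k = maya_part ({n. n < 0} \<union> weave (betas l1 mu) (betas l2 nu))"
    by (simp only: weave_maya)
  obtain lam where lam: "is_partition lam" "length lam \<le> l1 + l2" "betas (l1 + l2) lam = weave (betas l1 mu) (betas l2 nu)"
  proof -
    have "finite (weave (betas l1 mu) (betas l2 nu))" by (simp add: weave_def)
    thus ?thesis
    proof (rule partition_of_betas)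
      show "\<And>n. n \<in> weave (betas l1 mu) (betas l2 nu) \<Longrightarrow> 0 \<le> n" by (rule weave_nonneg)
    qed (use that in \<open>unfold card_weave[OF mu(1) nu(1)]\<close>)
  qed
  have M: "maya_beta (l1 + l2) lam = {n. n < 0} \<union> weave (betas l1 mu) (betas l2 nu)"
    by (simp add: maya_beta_def lam(3))
  have Phi_lam: "Phi mu nu k = lam"
    unfolding Phi M[symmetric] by (rule maya_part_beta[OF lam(1,2)])
  show "is_partition (Phi mu nu k)" "length (Phi mu nu k) \<le> L1 + L2"
    unfolding Phi_lam using lam t t2 by auto
  \<comment> \<open>Padding both components by \<open>t\<close> becomes a translation by
    \<open>2 * t\<close> after doubling.\<close>
  have "maya_beta (l1 + l2 + 2 * t) lam = (\<lambda>m. m + int (2 * t)) ` maya_beta (l1 + l2) lam"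
    by (rule maya_beta_shift[OF lam(2)])
  also have "\<dots> = (\<lambda>m. m + int (2 * t)) ` ((\<lambda>m. 2 * m) ` maya_beta l1 mu \<union> (\<lambda>m. 2 * m + 1) ` maya_beta l2 nu)"
    unfolding M weave_maya ..
  also have "\<dots> = (\<lambda>m. 2 * m) ` (\<lambda>m. m + int t) ` maya_beta l1 mu \<union> (\<lambda>m. 2 * m + 1) ` (\<lambda>m. m + int t) ` maya_beta l2 nu"
    by (simp add: image_Un image_image algebra_simps)
  also have "\<dots> = (\<lambda>m. 2 * m) ` maya_beta L1 mu \<union> (\<lambda>m. 2 * m + 1) ` maya_beta L2 nu"
    unfolding t t2 by (simp add: maya_beta_shift l1_def l2_def)
  also have "\<dots> = {n. n < 0} \<union> weave (betas L1 mu) (betas L2 nu)" by (rule weave_maya)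
  finally have "betas (l1 + l2 + 2 * t) lam = weave (betas L1 mu) (betas L2 nu)"
    by (rule maya_beta_eqD) (rule weave_nonneg)
  moreover have "l1 + l2 + 2 * t = L1 + L2" using t t2 by simp
  ultimately show "betas (L1 + L2) (Phi mu nu k) = weave (betas L1 mu) (betas L2 nu)"
    unfolding Phi_lam by simp
qed

section \<open>Domino removal\<close>

text \<open>Asymmetric on purpose: the double product over a set meets each pair in both orders, and
  an inversion of opposite parities must be counted once.\<close>

definition inv_factor :: "int \<Rightarrow> int \<Rightarrow> real" where
  "inv_factor x y = (if even x \<and> odd y \<and> y < x then - 1 else 1)"

text \<open>Up to a constant depending only on the two padded lengths, this is the sign of the Vandermonde
  product when the even beta numbers are listed first; removing a domino changes it exactly when the
  domino is vertical.\<close>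

definition inv_sign :: "int set \<Rightarrow> real" where
  "inv_sign B = (\<Prod>x\<in>B. \<Prod>y\<in>B. inv_factor x y)"

lemma inv_sign_square: "inv_sign B * inv_sign B = 1"
  unfolding inv_sign_def prod.distrib[symmetric] by (intro prod.neutral ballI) (auto simp: inv_factor_def)

lemma inv_sign_insert:
  assumes "finite C" "n \<notin> C"
  shows "inv_sign (insert n C) = inv_sign C * (\<Prod>y\<in>C. inv_factor n y * inv_factor y n)"
  unfolding inv_sign_def using assms
  by (simp add: prod.distrib inv_factor_def[of n n] mult_ac)

text \<open>Moving \<open>n\<close> down by two preserves its parity and its order relative to
  everything except \<open>n - 1\<close>, which has the opposite parity and thus flips exactly one
  factor.\<close>

lemma inv_sign_move:
  assumes "finite B" "n \<in> B" "n - 2 \<notin> B"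
  shows "inv_sign (insert (n - 2) (B - {n})) = inv_sign B * (if n - 1 \<in> B then - 1 else 1)"
proof -
  define C where "C = B - {n}"
  have C: "finite C" "n \<notin> C" "n - 2 \<notin> C" "B = insert n C" "n - 1 \<in> C \<longleftrightarrow> n - 1 \<in> B"
    using assms by (auto simp: C_def)
  have "inv_factor (n - 2) y * inv_factor y (n - 2) =
      inv_factor n y * inv_factor y n * (if y = n - 1 then - 1 else 1)" if "y \<in> C" for y
  proof -
    have "y \<noteq> n" "y \<noteq> n - 2" using that C by auto
    then consider "y = n - 1" | "y > n" | "y < n - 2" by linarith
    thus ?thesis by cases (auto simp: inv_factor_def)
  qed
  hence "(\<Prod>y\<in>C. inv_factor (n - 2) y * inv_factor y (n - 2)) =
      (\<Prod>y\<in>C. inv_factor n y * inv_factor y n) * (\<Prod>y\<in>C. if y = n - 1 then - 1 else 1)"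
    unfolding prod.distrib[symmetric] by (intro prod.cong refl) (simp add: mult_ac)
  also have "(\<Prod>y\<in>C. if y = n - 1 then - 1 else 1) = (if n - 1 \<in> B then - 1 else (1::real))"
    using C(1) C(5) by simp
  finally have "inv_sign (insert (n - 2) C) = inv_sign (insert n C) * (if n - 1 \<in> B then - 1 else 1)"
    using inv_sign_insert[OF C(1,2)] inv_sign_insert[OF C(1,3)] by simp
  thus ?thesis unfolding C(4)[symmetric] by (simp only: C_def)
qed

lemma inv_sign_weave:
  assumes "finite A" "finite B"
  shows "inv_sign (weave A B) = (\<Prod>x\<in>A. \<Prod>y\<in>B. if 2 * y + 1 < 2 * x then - 1 else 1)"
proof -
  let ?E = "(\<lambda>n. 2 * n) ` A" and ?O = "(\<lambda>n. 2 * n + 1) ` B"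
  have disj: "?E \<inter> ?O = {}" by (auto, presburger)
  have split: "prod f (weave A B) = prod f ?E * prod f ?O" for f :: "int \<Rightarrow> real"
    unfolding weave_def by (rule prod.union_disjoint) (use assms disj in auto)
  have "(\<Prod>x\<in>?O. \<Prod>y\<in>weave A B. inv_factor x y) = 1"
    by (intro prod.neutral) (auto simp: inv_factor_def)
  moreover have "(\<Prod>y\<in>?E. inv_factor x y) = 1" for x
    by (intro prod.neutral) (auto simp: inv_factor_def)
  ultimately have "inv_sign (weave A B) = (\<Prod>x\<in>?E. \<Prod>y\<in>?O. inv_factor x y)"
    unfolding inv_sign_def by (subst split) (simp add: split)
  thus ?thesis by (simp add: prod.reindex inj_on_def inv_factor_def)
qed

lemma betas_update:
  assumes inj: "inj (beta L l)" and i: "i < L" and upd: "beta L m = (beta L l)(i := x)"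
  shows "betas L m = insert x (betas L l - {beta L l i})"
  unfolding upd using i injD[OF inj] by (auto simp: image_iff)

lemma horizontal_domino_iff:
  assumes "\<And>i. part m i \<le> part l i"
  shows "cells l - cells m = {(i, j), (i, Suc j)} \<longleftrightarrow> part l i = j + 2 \<and> part m = (part l)(i := j)"
proof
  assume e: "cells l - cells m = {(i, j), (i, Suc j)}"
  have mem: "part m i' \<le> j' \<and> j' < part l i' \<longleftrightarrow> i' = i \<and> (j' = j \<or> j' = Suc j)" for i' j'
  proof -
    have "(i', j') \<in> cells l - cells m \<longleftrightarrow> i' = i \<and> (j' = j \<or> j' = Suc j)" unfolding e by auto
    thus ?thesis unfolding cells_part by (simp add: not_less conj_commute)
  qed
  have "part m i' = part l i'" if "i' \<noteq> i" for i'
    using mem[of i' "part m i'"] that assms[of i'] by auto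
  moreover have "part m i = j" "part l i = j + 2"
    using mem[of i j] mem[of i "Suc j"] mem[of i "j + 2"] mem[of i "part m i"] by auto
  ultimately show "part l i = j + 2 \<and> part m = (part l)(i := j)" by auto
next
  assume "part l i = j + 2 \<and> part m = (part l)(i := j)"
  thus "cells l - cells m = {(i, j), (i, Suc j)}" by (auto simp: cells_part split: if_splits)
qed

lemma vertical_domino_iff:
  assumes "\<And>i. part m i \<le> part l i"
  shows "cells l - cells m = {(i, j), (Suc i, j)} \<longleftrightarrow>
    part l i = Suc j \<and> part l (Suc i) = Suc j \<and> part m = (part l)(i := j, Suc i := j)"
proof
  assume e: "cells l - cells m = {(i, j), (Suc i, j)}"
  have mem: "part m i' \<le> j' \<and> j' < part l i' \<longleftrightarrow> (i' = i \<or> i' = Suc i) \<and> j' = j" for i' j'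
  proof -
    have "(i', j') \<in> cells l - cells m \<longleftrightarrow> (i' = i \<or> i' = Suc i) \<and> j' = j" unfolding e by auto
    thus ?thesis unfolding cells_part by (simp add: not_less conj_commute)
  qed
  have "part m i' = part l i'" if "i' \<noteq> i" "i' \<noteq> Suc i" for i'
    using mem[of i' "part m i'"] that assms[of i'] by auto
  moreover have "part m i' = j" "part l i' = Suc j" if "i' = i \<or> i' = Suc i" for i'
    using that mem[of i' j] mem[of i' "Suc j"] mem[of i' "part m i'"] by auto
  ultimately show "part l i = Suc j \<and> part l (Suc i) = Suc j \<and> part m = (part l)(i := j, Suc i := j)" by auto
next
  assume "part l i = Suc j \<and> part l (Suc i) = Suc j \<and> part m = (part l)(i := j, Suc i := j)"
  thus "cells l - cells m = {(i, j), (Suc i, j)}" by (auto simp: cells_part split: if_splits)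
qed

lemma part_pos_less: "is_partition l \<Longrightarrow> length l \<le> L \<Longrightarrow> 0 < part l i \<Longrightarrow> i < L"
  using part_pos_iff[of l i] by simp

text \<open>One beta number drops by two without passing another.\<close>

lemma horizontal_domino_move:
  assumes l: "is_partition l" "length l \<le> L" and m: "is_partition m" "cells m \<subseteq> cells l"
    and diff: "cells l - cells m = {(i, j), (i, Suc j)}"
  obtains n where "n \<in> betas L l" "n - 2 \<notin> betas L l" "n - 1 \<notin> betas L l"
    "betas L m = insert (n - 2) (betas L l - {n})"
proof -
  have p: "part l i = j + 2" "part m = (part l)(i := j)"
    using diff horizontal_domino_iff[of m l i j] m(2) by (auto simp: cells_subset_iff)
  have i: "i < L" using part_pos_less[OF l] p(1) by simp
  define n where "n = beta L l i"
  have upd: "beta L m = (beta L l)(i := n - 2)"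
    using p by (auto simp: beta_def n_def)
  \<comment> \<open>Later rows are unchanged in \<open>m\<close> and must stay below its lowered
    beta number; this keeps \<open>n - 2\<close> and \<open>n - 1\<close> free.\<close>
  have other: "beta L l i' < n - 2 \<or> n < beta L l i'" if "i' \<noteq> i" for i'
  proof (cases "i < i'")
    case True
    thus ?thesis using beta_less[OF m(1) True, of L] upd that by simp
  next
    case False
    thus ?thesis using beta_less[OF l(1), of i' i L] that by (simp add: n_def)
  qed
  have "n - 2 \<noteq> beta L l i'" "n - 1 \<noteq> beta L l i'" for i'
    using other[of i'] by (cases "i' = i"; force simp: n_def)+
  hence "n - 2 \<notin> betas L l" "n - 1 \<notin> betas L l" by auto
  moreover have "n \<in> betas L l" using i by (simp add: n_def)
  moreover have "betas L m = insert (n - 2) (betas L l - {n})"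
    unfolding n_def by (rule betas_update[OF beta_inj[OF l(1)] i]) (use upd n_def in simp)
  ultimately show ?thesis using that by blast
qed

text \<open>Rows \<open>i\<close> and \<open>Suc i\<close> have beta numbers \<open>n\<close>,
  \<open>n - 1\<close> before and \<open>n - 1\<close>, \<open>n - 2\<close> after. As a set this is
  \<open>n\<close> jumping over the occupied \<open>n - 1\<close>.\<close>

lemma vertical_domino_move:
  assumes l: "is_partition l" "length l \<le> L" and m: "is_partition m" "cells m \<subseteq> cells l"
    and diff: "cells l - cells m = {(i, j), (Suc i, j)}"
  obtains n where "n \<in> betas L l" "n - 2 \<notin> betas L l" "n - 1 \<in> betas L l"
    "betas L m = insert (n - 2) (betas L l - {n})"
proof -
  have p: "part l i = Suc j" "part l (Suc i) = Suc j" "part m = (part l)(i := j, Suc i := j)"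
    using diff vertical_domino_iff[of m l i j] m(2) by (auto simp: cells_subset_iff)
  have i: "Suc i < L" using part_pos_less[OF l, of "Suc i"] p(2) by simp
  define n where "n = beta L l i"
  have n1: "beta L l (Suc i) = n - 1" using p by (simp add: n_def beta_def)
  have upd: "beta L m = (beta L l)(i := n - 1, Suc i := n - 2)"
    using p by (auto simp: beta_def n_def)
  have "n - 2 \<noteq> beta L l i'" for i'
    using injD[OF beta_inj[OF m(1)], of L i' "Suc i"] n1 unfolding upd
    by (cases "i' = i"; cases "i' = Suc i") (auto simp: n_def)
  hence "n - 2 \<notin> betas L l" by auto
  moreover have "n \<in> betas L l" using i by (auto simp: n_def)
  moreover have "n - 1 \<in> betas L l" using i n1 by (metis imageI lessThan_iff)
  moreover have "betas L m = insert (n - 2) (betas L l - {n})"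
  proof -
    have inj: "inj (beta L l)" by (rule beta_inj[OF l(1)])
    have "{..<L} = insert i (insert (Suc i) ({..<L} - {i, Suc i}))" using i by auto
    hence dom: "f ` {..<L} = insert (f i) (insert (f (Suc i)) (f ` ({..<L} - {i, Suc i})))" for f :: "nat \<Rightarrow> int"
      by (metis image_insert)
    have "beta L m ` ({..<L} - {i, Suc i}) = beta L l ` ({..<L} - {i, Suc i})"
      by (rule image_cong) (auto simp: upd)
    moreover have "n \<notin> beta L l ` ({..<L} - {i, Suc i})"
      using injD[OF inj] by (auto simp: n_def)
    ultimately show ?thesis
      unfolding dom[of "beta L m"] dom[of "beta L l"] n1 n_def[symmetric] by (auto simp: upd)
  qed
  ultimately show ?thesis using that by blast
qed

text \<open>Only vertical dominoes change \<open>inv_sign\<close>, so the parity of \<open>v\<close>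
  is fixed by the two ends of the chain; the arbitrary choice in \<open>ht2\<close> is therefore
  harmless.\<close>

lemma dchain_sign:
  assumes "dchain l l' v" "is_partition l" "length l \<le> L"
  shows "inv_sign (betas L l) * inv_sign (betas L l') = (- 1) ^ v"
  using assms
proof (induction rule: dchain.induct)
  case (dchain_refl l)
  show ?case by (simp add: inv_sign_square)
next
  case (dchain_hor m l i j l' v)
  have len: "length m \<le> L"
    using length_le_of_subset[OF dchain_hor.hyps(1) dchain_hor.prems(1) dchain_hor.hyps(2)] dchain_hor.prems by simp
  obtain n where n: "n \<in> betas L l" "n - 2 \<notin> betas L l" "n - 1 \<notin> betas L l"
    "betas L m = insert (n - 2) (betas L l - {n})"
    using horizontal_domino_move[OF dchain_hor.prems dchain_hor.hyps(1-3)] by blast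
  have "inv_sign (betas L m) = inv_sign (betas L l)"
    unfolding n(4) using inv_sign_move[of "betas L l" n] n by simp
  thus ?case using dchain_hor.IH dchain_hor.hyps(1) len by simp
next
  case (dchain_ver m l i j l' v)
  have len: "length m \<le> L"
    using length_le_of_subset[OF dchain_ver.hyps(1) dchain_ver.prems(1) dchain_ver.hyps(2)] dchain_ver.prems by simp
  obtain n where n: "n \<in> betas L l" "n - 2 \<notin> betas L l" "n - 1 \<in> betas L l"
    "betas L m = insert (n - 2) (betas L l - {n})"
    using vertical_domino_move[OF dchain_ver.prems dchain_ver.hyps(1-3)] by blast
  have "inv_sign (betas L m) = - inv_sign (betas L l)"
    unfolding n(4) using inv_sign_move[of "betas L l" n] n by simp
  thus ?case using dchain_ver.IH dchain_ver.hyps(1) len by simp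
qed

text \<open>The converse direction. If \<open>n - 1\<close> is free, the row of \<open>n\<close> can
  lose two boxes. Otherwise \<open>n - 1\<close> belongs to the next row, which has equal length,
  and both rows lose one box. The shape so obtained is identified with \<open>m\<close> by its beta
  numbers.\<close>

lemma domino_of_move:
  assumes l: "is_partition l" "length l \<le> L" and m: "is_partition m" "length m \<le> L"
    and n: "n \<in> betas L l" "n - 2 \<notin> betas L l" and bm: "betas L m = insert (n - 2) (betas L l - {n})"
  shows "cells m \<subseteq> cells l \<and>
    ((\<exists>i j. cells l - cells m = {(i, j), (i, Suc j)}) \<or> (\<exists>i j. cells l - cells m = {(i, j), (Suc i, j)}))"
proof -
  obtain i where i: "i < L" "n = beta L l i" using n(1) by auto
  have "n - 2 \<in> betas L m" using bm by auto
  \<comment> \<open>Being a beta number of \<open>m\<close>, \<open>n - 2\<close> is nonnegative.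
    This guarantees enough boxes when the move involves the last padded row.\<close>
  hence n2: "2 \<le> n" using betas_nonneg[of "n - 2" L m] by linarith
  show ?thesis
  proof (cases "n - 1 \<in> betas L l")
    case False
    have gap: "part l (Suc i) + 2 \<le> part l i"
    proof (cases "Suc i < L")
      case True
      hence "beta L l (Suc i) \<noteq> n - 1" "beta L l (Suc i) \<noteq> n - 2" using False n(2) by (metis imageI lessThan_iff)+
      moreover have "beta L l (Suc i) < n" using beta_less[OF l(1), of i "Suc i" L] i by simp
      ultimately show ?thesis using i by (simp add: beta_def)
    next
      case False
      hence "Suc i = L" using i by simp
      thus ?thesis using n2 i part_beyond[OF l(2)] by (auto simp: beta_def)
    qed
    obtain m0 where m0: "is_partition m0" "part m0 = (part l)(i := part l i - 2)" "length m0 \<le> L"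
    proof (rule partition_exists[of "(part l)(i := part l i - 2)" L])
      show "((part l)(i := part l i - 2)) (Suc i') \<le> ((part l)(i := part l i - 2)) i'" for i'
        using gap part_antimono[OF l(1), of i' "Suc i'"] by auto
      show "((part l)(i := part l i - 2)) L = 0" using part_beyond[OF l(2)] i(1) by simp
    qed (use that in blast)
    have "betas L m0 = insert (n - 2) (betas L l - {n})"
      unfolding i(2) by (rule betas_update[OF beta_inj[OF l(1)] i(1)]) (use gap in \<open>auto simp: beta_def m0(2)\<close>)
    hence "m0 = m" using betas_inject[OF m0(1,3) m] bm by simp
    hence p: "part m = (part l)(i := part l i - 2)" using m0(2) by simp
    hence le: "part m i' \<le> part l i'" for i' by simp
    have "cells l - cells m = {(i, part l i - 2), (i, Suc (part l i - 2))}"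
      unfolding horizontal_domino_iff[OF le] using p gap by simp
    thus ?thesis using le by (auto simp: cells_subset_iff)
  next
    case True
    then obtain i' where i': "i' < L" "n - 1 = beta L l i'" by auto
    have "i < i'" using beta_less[OF l(1), of i' i L] i i' by (cases i i' rule: linorder_cases) auto
    moreover have "\<not> Suc i < i'"
      using beta_less[OF l(1), of "Suc i" i' L] beta_less[OF l(1), of i "Suc i" L] i i' by auto
    ultimately have Si: "i' = Suc i" by simp
    have eq: "part l (Suc i) = part l i" using i i' unfolding Si by (simp add: beta_def)
    have gap: "part l (Suc (Suc i)) < part l i"
    proof (cases "Suc (Suc i) < L")
      case True
      hence "beta L l (Suc (Suc i)) \<noteq> n - 2" using n(2) by (metis imageI lessThan_iff)
      moreover have "beta L l (Suc (Suc i)) < n - 1"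
        using beta_less[OF l(1), of "Suc i" "Suc (Suc i)" L] i' unfolding Si by simp
      ultimately show ?thesis using i by (simp add: beta_def)
    next
      case False
      hence "Suc (Suc i) = L" using i' unfolding Si by simp
      thus ?thesis using n2 i part_beyond[OF l(2)] by (auto simp: beta_def)
    qed
    let ?p = "(part l)(i := part l i - 1, Suc i := part l i - 1)"
    obtain m0 where m0: "is_partition m0" "part m0 = ?p" "length m0 \<le> L"
    proof (rule partition_exists[of ?p L])
      show "?p (Suc i'') \<le> ?p i''" for i''
        using gap eq part_antimono[OF l(1), of i'' "Suc i''"] by auto
      show "?p L = 0" using part_beyond[OF l(2)] i' unfolding Si by auto
    qed (use that in blast)
    have le0: "part m0 i'' \<le> part l i''" for i'' using eq by (simp add: m0(2))
    have diff: "cells l - cells m0 = {(i, part l i - 1), (Suc i, part l i - 1)}"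
      unfolding vertical_domino_iff[OF le0] using gap eq m0(2) by simp
    have sub0: "cells m0 \<subseteq> cells l" using le0 by (simp add: cells_subset_iff)
    obtain n' where n': "n' \<in> betas L l" "n' - 2 \<notin> betas L l" "n' - 1 \<in> betas L l"
        "betas L m0 = insert (n' - 2) (betas L l - {n'})"
      using vertical_domino_move[OF l m0(1) sub0 diff] .
    have "n \<notin> betas L m0"
    proof
      assume "n \<in> betas L m0"
      then obtain i0 where "n = beta L m0 i0" by auto
      hence "beta L l i0 \<ge> n" "i0 \<noteq> i" "i0 \<noteq> Suc i" "beta L l i0 = n"
        using gap eq i by (auto simp: beta_def m0(2) split: if_splits)
      thus False using injD[OF beta_inj[OF l(1)], of L i0 i] i by simp
    qed
    \<comment> \<open>\<open>vertical_domino_move\<close> does not say which beta number moved;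
      \<open>n\<close> is the one that is missing afterwards.\<close>
    hence "n' = n" using n' n(1) by auto
    hence "m0 = m" using betas_inject[OF m0(1,3) m] bm n' by simp
    thus ?thesis using diff sub0 by blast
  qed
qed

section \<open>From box removals in the quotient to domino chains\<close>

lemma dchain_of_move:
  assumes "is_partition l" "length l \<le> L" "is_partition m" "length m \<le> L"
    "n \<in> betas L l" "n - 2 \<notin> betas L l" "betas L m = insert (n - 2) (betas L l - {n})"
    and chain: "dchain m l' v"
  shows "\<exists>v'. dchain l l' v'"
  using domino_of_move[OF assms(1-7)] dchain_hor[OF assms(3) _ _ chain] dchain_ver[OF assms(3) _ _ chain]
  by blast

text \<open>The last row in which \<open>a\<close> and \<open>mu\<close> differ ends in a removable
  corner of \<open>mu\<close> outside \<open>a\<close>.\<close>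

lemma lower_cover_above:
  assumes mu: "is_partition mu" and a: "is_partition a" and sub: "cells a \<subseteq> cells mu" and "a \<noteq> mu"
  obtains m where "m \<in> lower_covers mu" "cells a \<subseteq> cells m"
proof -
  define I where "I = {i. part a i < part mu i}"
  have le: "part a i \<le> part mu i" for i using sub by (simp add: cells_subset_iff)
  have "I \<noteq> {}" using partition_eqI[OF a mu] le \<open>a \<noteq> mu\<close> unfolding I_def
    by (metis (mono_tags, lifting) empty_iff le_neq_implies_less mem_Collect_eq)
  have "i < length mu" if "i \<in> I" for i
    using that part_pos_iff[OF mu, of i] by (simp add: I_def)
  hence "I \<subseteq> {..<length mu}" by blast
  hence fin: "finite I" by (rule finite_subset) simp
  define i where "i = Max I"
  have i: "i \<in> I" unfolding i_def using Max_in[OF fin \<open>I \<noteq> {}\<close>] .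
  have "Suc i \<notin> I" using Max_ge[OF fin, of "Suc i"] unfolding i_def by auto
  hence "part mu (Suc i) \<le> part a (Suc i)" by (simp add: I_def)
  also have "\<dots> \<le> part a i" using part_antimono[OF a, of i "Suc i"] by simp
  finally have corner: "part mu (Suc i) < part mu i" using i by (simp add: I_def)
  obtain m where m: "is_partition m" "part m = (part mu)(i := part mu i - 1)"
    using remove_box[OF mu corner] by blast
  have "m \<in> lower_covers mu" using lower_covers_iff[OF mu] m corner by blast
  moreover have "cells a \<subseteq> cells m"
    using le i unfolding cells_subset_iff m(2) by (auto simp: I_def)
  ultimately show ?thesis using that by blast
qed

lemma lower_cover_move:
  assumes mu: "is_partition mu" "length mu \<le> L" and m: "m \<in> lower_covers mu"
  obtains x where "x \<in> betas L mu" "x - 1 \<notin> betas L mu" "betas L m = insert (x - 1) (betas L mu - {x})"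
proof -
  obtain i where i: "part mu (Suc i) < part mu i" "part m = (part mu)(i := part mu i - 1)"
    using m lower_covers_iff[OF mu(1)] by blast
  have iL: "i < L" using part_pos_less[OF mu] i(1) by simp
  have upd: "beta L m = (beta L mu)(i := beta L mu i - 1)"
    using i by (auto simp: beta_def)
  have "beta L mu i' \<noteq> beta L mu i - 1" for i'
    using injD[OF beta_inj[OF lower_coverE(1)[OF m]], of L i' i] unfolding upd by (cases "i' = i") auto
  hence "beta L mu i - 1 \<notin> betas L mu" by (metis imageE)
  thus ?thesis using that[of "beta L mu i"] betas_update[OF beta_inj[OF mu(1)] iL upd] iL by simp
qed

lemma even_mem_weave: "2 * y \<in> weave A B \<longleftrightarrow> y \<in> A"
proof -
  have "2 * y \<noteq> 2 * z + 1" for z :: int by presburger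
  thus ?thesis by (auto simp: weave_def)
qed

lemma odd_mem_weave: "2 * y + 1 \<in> weave A B \<longleftrightarrow> y \<in> B"
proof -
  have "2 * y + 1 \<noteq> 2 * z" for z :: int by presburger
  thus ?thesis by (auto simp: weave_def)
qed

lemma parity_set_eqI:
  fixes S T :: "int set"
  assumes "\<And>y. 2 * y \<in> S \<longleftrightarrow> 2 * y \<in> T" "\<And>y. 2 * y + 1 \<in> S \<longleftrightarrow> 2 * y + 1 \<in> T"
  shows "S = T"
proof (rule Set.set_eqI)
  fix n :: int
  show "n \<in> S \<longleftrightarrow> n \<in> T"
    by (cases "even n") (auto elim!: evenE oddE simp: assms)
qed

lemma weave_move_even:
  assumes "x \<in> A" "x - 1 \<notin> A"
  shows "2 * x \<in> weave A B" "2 * x - 2 \<notin> weave A B"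
    "weave (insert (x - 1) (A - {x})) B = insert (2 * x - 2) (weave A B - {2 * x})"
proof -
  have e: "2 * x - 2 = 2 * (x - 1)" by simp
  have par: "2 * y + 1 \<noteq> 2 * z" for y z :: int by presburger
  show "2 * x \<in> weave A B" "2 * x - 2 \<notin> weave A B"
    unfolding e even_mem_weave using assms by auto
  show "weave (insert (x - 1) (A - {x})) B = insert (2 * x - 2) (weave A B - {2 * x})"
    unfolding e
  proof (rule parity_set_eqI)
    fix y
    have "2 * y = 2 * z \<longleftrightarrow> y = z" for z :: int by simp
    thus "2 * y \<in> weave (insert (x - 1) (A - {x})) B \<longleftrightarrow> 2 * y \<in> insert (2 * (x - 1)) (weave A B - {2 * x})"
      by (simp only: even_mem_weave insert_iff Diff_iff empty_iff)
    show "2 * y + 1 \<in> weave (insert (x - 1) (A - {x})) B \<longleftrightarrow> 2 * y + 1 \<in> insert (2 * (x - 1)) (weave A B - {2 * x})"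
      by (simp only: odd_mem_weave insert_iff Diff_iff empty_iff par simp_thms)
  qed
qed

lemma weave_move_odd:
  assumes "x \<in> B" "x - 1 \<notin> B"
  shows "2 * x + 1 \<in> weave A B" "2 * x + 1 - 2 \<notin> weave A B"
    "weave A (insert (x - 1) (B - {x})) = insert (2 * x + 1 - 2) (weave A B - {2 * x + 1})"
proof -
  have e: "2 * x + 1 - 2 = 2 * (x - 1) + 1" by simp
  have par: "2 * y \<noteq> 2 * z + 1" for y z :: int by presburger
  show "2 * x + 1 \<in> weave A B" "2 * x + 1 - 2 \<notin> weave A B"
    unfolding e odd_mem_weave using assms by auto
  show "weave A (insert (x - 1) (B - {x})) = insert (2 * x + 1 - 2) (weave A B - {2 * x + 1})"
    unfolding e
  proof (rule parity_set_eqI)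
    fix y
    have "2 * y + 1 = 2 * z + 1 \<longleftrightarrow> y = z" for z :: int by simp
    thus "2 * y + 1 \<in> weave A (insert (x - 1) (B - {x})) \<longleftrightarrow> 2 * y + 1 \<in> insert (2 * (x - 1) + 1) (weave A B - {2 * x + 1})"
      by (simp only: odd_mem_weave insert_iff Diff_iff empty_iff)
    show "2 * y \<in> weave A (insert (x - 1) (B - {x})) \<longleftrightarrow> 2 * y \<in> insert (2 * (x - 1) + 1) (weave A B - {2 * x + 1})"
      by (simp only: even_mem_weave insert_iff Diff_iff empty_iff par simp_thms)
  qed
qed

text \<open>Removing one box from a component lowers one of its beta numbers by one, hence an
  interleaved beta number by two, which removes a domino from the large partition.\<close>

lemma dchain_Phi:
  assumes "is_partition mu" "is_partition nu" "(a, b) \<in> below mu nu"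
  shows "\<exists>v. dchain (Phi mu nu (int k)) (Phi a b (int k)) v"
  using assms
proof (induction "psize mu + psize nu" arbitrary: mu nu rule: less_induct)
  case less
  note mu = less.prems(1) and nu = less.prems(2)
  have ab: "is_partition a" "is_partition b" "cells a \<subseteq> cells mu" "cells b \<subseteq> cells nu"
    using less.prems(3) by (auto simp: below_def)
  define L1 L2 where "L1 = length mu + length nu" and "L2 = L1 + k"
  have len: "length mu \<le> L1" "length nu \<le> L2" "int L2 = int L1 + int k"
    by (simp_all add: L1_def L2_def)
  note Phi = betas_Phi[OF mu len(1) nu len(2,3)]
  consider "a = mu" "b = nu" | "a \<noteq> mu" | "b \<noteq> nu" by blast
  thus ?case
  proof cases
    case 1
    thus ?thesis by (auto intro: dchain_refl)
  next
    case 2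
    obtain m where m: "m \<in> lower_covers mu" "cells a \<subseteq> cells m"
      using lower_cover_above[OF mu ab(1,3) 2] .
    note m' = lower_coverE[OF m(1)]
    have lm: "length m \<le> L1" using length_le_of_subset[OF m'(1) mu m'(2)] len by simp
    note Phim = betas_Phi[OF m'(1) lm nu len(2,3)]
    obtain v where v: "dchain (Phi m nu (int k)) (Phi a b (int k)) v"
      using less.hyps[of m nu] psize_lower_cover[OF m(1)] m' m(2) nu ab by (auto simp: below_def)
    obtain x where x: "x \<in> betas L1 mu" "x - 1 \<notin> betas L1 mu" "betas L1 m = insert (x - 1) (betas L1 mu - {x})"
      using lower_cover_move[OF mu len(1) m(1)] .
    note w = weave_move_even[OF x(1,2), of "betas L2 nu"]
    show ?thesis
      by (rule dchain_of_move[OF Phi(1,2) Phim(1,2) _ _ _ v, of "2 * x"])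
         (use w Phi(3) Phim(3) x(3) in simp_all)
  next
    case 3
    obtain n where n: "n \<in> lower_covers nu" "cells b \<subseteq> cells n"
      using lower_cover_above[OF nu ab(2,4) 3] .
    note n' = lower_coverE[OF n(1)]
    have ln: "length n \<le> L2" using length_le_of_subset[OF n'(1) nu n'(2)] len by simp
    note Phin = betas_Phi[OF mu len(1) n'(1) ln len(3)]
    obtain v where v: "dchain (Phi mu n (int k)) (Phi a b (int k)) v"
      using less.hyps[of mu n] psize_lower_cover[OF n(1)] n' n(2) mu ab by (auto simp: below_def)
    obtain x where x: "x \<in> betas L2 nu" "x - 1 \<notin> betas L2 nu" "betas L2 n = insert (x - 1) (betas L2 nu - {x})"
      using lower_cover_move[OF nu len(2) n(1)] .
    note w = weave_move_odd[OF x(1,2), of "betas L1 mu"]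
    show ?thesis
      by (rule dchain_of_move[OF Phi(1,2) Phin(1,2) _ _ _ v, of "2 * x + 1"])
         (use w Phi(3) Phin(3) x(3) in simp_all)
  qed
qed

text \<open>\<open>dchain_Phi\<close> supplies a chain, so the choice in \<open>ht2\<close> is a
  genuine height, and \<open>dchain_sign\<close> evaluates its parity.\<close>

lemma ht2_sign:
  assumes mu: "is_partition mu" "length mu \<le> L1" and nu: "is_partition nu" "length nu \<le> L2"
    and ab: "(a, b) \<in> below mu nu" and k: "L2 = L1 + k"
  shows "(- 1) ^ ht2 (Phi mu nu (int k)) (Phi a b (int k)) =
    inv_sign (weave (betas L1 mu) (betas L2 nu)) * inv_sign (weave (betas L1 a) (betas L2 b))"
proof -
  have ab0: "is_partition a" "is_partition b" "cells a \<subseteq> cells mu" "cells b \<subseteq> cells nu"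
    using ab by (simp_all add: below_def)
  hence ab': "is_partition a" "is_partition b" "length a \<le> L1" "length b \<le> L2"
    using mu nu length_le_of_subset[OF ab0(1) mu(1)] length_le_of_subset[OF ab0(2) nu(1)] by simp_all
  have k': "int L2 = int L1 + int k" by (simp add: k)
  note P = betas_Phi[OF mu nu k'] and Q = betas_Phi[OF ab'(1,3,2,4) k']
  have "dchain (Phi mu nu (int k)) (Phi a b (int k)) (ht2 (Phi mu nu (int k)) (Phi a b (int k)))"
    unfolding ht2_def using dchain_Phi[OF mu(1) nu(1) ab] by (rule someI_ex)
  from dchain_sign[OF this P(1,2)] show ?thesis by (simp only: P(3) Q(3))
qed

section \<open>Coefficients of the Wronskian Hermite polynomials\<close>

text \<open>Padding and reordering rows multiply both determinants by the same sign; this is why the even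
  beta numbers may be listed first.\<close>

lemma HeP_beta:
  assumes "length lam \<le> L"
  shows "HeP lam = smult (1 / jtdet rfact L (beta L lam)) (jtdet nHe L (beta L lam))"
  using assms
proof (induction L rule: dec_induct)
  case base
  have e: "int (degvec lam ! i) = beta (length lam) lam i" if "i < length lam" for i
    using that by (simp add: degvec_def beta_def part_def of_nat_diff)
  have "jtdet rfact (length lam) (\<lambda>i. int (degvec lam ! i)) = jtdet rfact (length lam) (beta (length lam) lam)"
    "jtdet nHe (length lam) (\<lambda>i. int (degvec lam ! i)) = jtdet nHe (length lam) (beta (length lam) lam)"
    by (intro jtdet_cong e; assumption)+
  thus ?case by (simp only: HeP_eq_jtdet)
next
  case (step L)
  have last: "beta (Suc L) lam L = 0"
    using part_beyond[OF step.hyps(1)] by (simp add: beta_def)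
  have shift: "(\<lambda>i. beta (Suc L) lam i - 1) = beta L lam"
    by (auto simp: beta_def)
  have pad: "jtdet rfact (Suc L) (beta (Suc L) lam) = (- 1) ^ L * jtdet rfact L (beta L lam)"
    "jtdet nHe (Suc L) (beta (Suc L) lam) = (- 1) ^ L * jtdet nHe L (beta L lam)"
    using jtdet_pad[where h = rfact and L = L and f = "beta (Suc L) lam", OF rfact_neg rfact_0 last]
      jtdet_pad[where h = nHe and L = L and f = "beta (Suc L) lam", OF nHe_neg nHe_0 last]
    unfolding shift by auto
  show ?case
    unfolding step.IH pad by (cases "even L") simp_all
qed

lemma HeP_rows:
  assumes "is_partition lam" "length lam \<le> L" and f: "inj_on f {..<L}" "f ` {..<L} = betas L lam"
  shows "HeP lam = smult (1 / jtdet rfact L f) (jtdet nHe L f)"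
proof -
  let ?b = "beta L lam"
  have inj: "inj_on ?b {..<L}" using beta_inj[OF assms(1)] by (rule inj_on_subset) simp
  define p where "p i = (if i < L then inv_into {..<L} ?b (f i) else i)" for i
  have "bij_betw (\<lambda>i. inv_into {..<L} ?b (f i)) {..<L} {..<L}"
    using bij_betw_trans[of f "{..<L}" "betas L lam" "inv_into {..<L} ?b" "{..<L}"]
      f inj bij_betw_inv_into[of ?b "{..<L}" "betas L lam"] by (auto simp: bij_betw_def o_def)
  hence "bij_betw p {..<L} {..<L}"
    by (rule bij_betw_cong[THEN iffD1, rotated]) (simp add: p_def)
  hence p: "p permutes {..<L}" by (rule bij_imp_permutes) (simp add: p_def)
  have "?b (p i) = f i" if "i < L" for i
  proof -
    have "f i \<in> betas L lam" using f(2) that by blast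
    thus ?thesis using that by (simp add: p_def f_inv_into_f)
  qed
  hence "jtdet rfact L f = jtdet rfact L (\<lambda>i. ?b (p i))" "jtdet nHe L f = jtdet nHe L (\<lambda>i. ?b (p i))"
    by (auto intro: jtdet_cong)
  hence "jtdet rfact L f = of_int (sign p) * jtdet rfact L ?b" "jtdet nHe L f = of_int (sign p) * jtdet nHe L ?b"
    by (simp_all only: jtdet_permute[OF p])
  thus ?thesis unfolding HeP_beta[OF assms(2)] by (cases p rule: sign_cases) simp_all
qed

text \<open>Pairs inside a block contribute a sign depending only on \<open>L1\<close> and
  \<open>L2\<close>, since beta numbers decrease. Pairs across the blocks give
  \<open>inv_sign\<close>. In the product of two such signs the constants square to 1.\<close>

lemma vsign_gam:
  assumes "is_partition mu" "is_partition nu" "is_partition a" "is_partition b"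
  shows "vsign (L1 + L2) (gam L1 L2 mu nu) * vsign (L1 + L2) (gam L1 L2 a b) =
    inv_sign (weave (betas L1 mu) (betas L2 nu)) * inv_sign (weave (betas L1 a) (betas L2 b))"
proof -
  let ?s = "\<lambda>n. (\<Prod>i<n. \<Prod>i'<i. - 1 :: real)"
  have v: "vsign (L1 + L2) (gam L1 L2 mu nu) = ?s L1 * ?s L2 * inv_sign (weave (betas L1 mu) (betas L2 nu))"
    if mn: "is_partition mu" "is_partition nu" for mu nu
  proof -
    have sgn: "sgn (beta L lam i - beta L lam i') = - 1" if "is_partition lam" "i' < i" for lam L i i'
      using beta_less[OF that, of L] by simp
    have even: "(\<Prod>i'<i. real_of_int (sgn (gam L1 L2 mu nu i - gam L1 L2 mu nu i'))) = (\<Prod>i'<i. - 1)"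
      if "i < L1" for i
    proof (intro prod.cong refl)
      fix i' assume "i' \<in> {..<i}"
      thus "real_of_int (sgn (gam L1 L2 mu nu i - gam L1 L2 mu nu i')) = - 1"
        using that beta_less[OF mn(1), of i' i L1] by (simp add: gam_def)
    qed
    have odd: "(\<Prod>i'<L1 + i. real_of_int (sgn (gam L1 L2 mu nu (L1 + i) - gam L1 L2 mu nu i')))
       = (\<Prod>i'<L1. if 2 * beta L2 nu i + 1 < 2 * beta L1 mu i' then - 1 else 1) * (\<Prod>i'<i. - 1)" for i
      unfolding prod_lessThan_add
    proof (intro arg_cong2[of _ _ _ _ "(*)"] prod.cong refl)
      fix i' assume "i' \<in> {..<L1}"
      have "2 * beta L2 nu i + 1 \<noteq> 2 * beta L1 mu i'" by presburger
      thus "real_of_int (sgn (gam L1 L2 mu nu (L1 + i) - gam L1 L2 mu nu i')) =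
          (if 2 * beta L2 nu i + 1 < 2 * beta L1 mu i' then - 1 else 1)"
        using \<open>i' \<in> {..<L1}\<close> by (simp add: gam_def sgn_if)
    next
      fix i' assume "i' \<in> {..<i}"
      thus "real_of_int (sgn (gam L1 L2 mu nu (L1 + i) - gam L1 L2 mu nu (L1 + i'))) = - 1"
        using beta_less[OF mn(2), of i' i L2] by (simp add: gam_def)
    qed
    have inj: "inj_on (beta L lam) {..<L}" if "is_partition lam" for L lam
      using beta_inj[OF that] by (rule inj_on_subset) simp
    have "inv_sign (weave (betas L1 mu) (betas L2 nu)) =
        (\<Prod>i<L2. \<Prod>i'<L1. if 2 * beta L2 nu i + 1 < 2 * beta L1 mu i' then - 1 else 1)"
      by (subst inv_sign_weave, simp, simp, subst prod.swap)
         (simp add: prod.reindex[OF inj[OF mn(1)]] prod.reindex[OF inj[OF mn(2)]] del: prod_constant)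
    thus ?thesis
      unfolding vsign_def prod_lessThan_add[of _ L1 L2] odd
      using even by (simp add: prod.distrib mult_ac del: prod_constant)
  qed
  have one: "?s n * ?s n = 1" for n :: nat
    unfolding prod.distrib[symmetric] by simp
  have "(x * y * p) * (x * y * q) = (x * x) * (y * y) * (p * q)" for x y p q :: real
    by (simp only: mult_ac)
  thus ?thesis unfolding v[OF assms(1,2)] v[OF assms(3,4)] by (simp only: one mult_1)
qed

lemma coeff_pcompose_square:
  fixes R :: "'a::comm_semiring_1 poly"
  shows "coeff (pcompose R [:0, 0, 1:]) d = (if even d then coeff R (d div 2) else 0)"
proof (induction R arbitrary: d)
  case (pCons a R)
  consider "d = 0" | "d = 1" | e where "d = Suc (Suc e)" by (metis One_nat_def not0_implies_Suc)
  thus ?case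
    by cases (use pCons in \<open>simp_all add: pcompose_pCons coeff_pCons\<close>)
qed simp

text \<open>\<open>Rpoly\<close> is a definite description: the support condition yields existence,
  and comparing coefficients yields uniqueness.\<close>

lemma coeff_Rpoly:
  assumes supp: "\<And>d. coeff (HeP lam) d \<noteq> 0 \<Longrightarrow> \<exists>u. d = c + 2 * u"
  shows "coeff (Rpoly lam c) u = coeff (HeP lam) (c + 2 * u)"
proof -
  let ?P = "HeP lam"
  \<comment> \<open>The upper limit is safe, since \<open>c + 2 * u\<close> exceeds the degree as
    soon as \<open>u\<close> does.\<close>
  define R where "R = (\<Sum>u\<le>degree ?P. monom (coeff ?P (c + 2 * u)) u)"
  have R: "coeff R u = coeff ?P (c + 2 * u)" for u
    unfolding R_def coeff_sum by (auto simp: sum.delta' intro!: coeff_eq_0)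
  have c: "coeff (monom 1 c * pcompose S [:0, 0, 1:]) d =
      (if c \<le> d \<and> even (d - c) then coeff S ((d - c) div 2) else 0)" for S :: "real poly" and d
    by (simp add: coeff_monom_mult coeff_pcompose_square)
  have "Rpoly lam c = R"
    unfolding Rpoly_def
  proof (rule the_equality)
    show "?P = monom 1 c * pcompose R [:0, 0, 1:]"
    proof (rule poly_eqI)
      fix d
      show "coeff ?P d = coeff (monom 1 c * pcompose R [:0, 0, 1:]) d"
      proof (cases "c \<le> d \<and> even (d - c)")
        case True
        hence "c + 2 * ((d - c) div 2) = d" by (metis dvd_mult_div_cancel le_add_diff_inverse)
        thus ?thesis using True by (simp only: c R if_True simp_thms)
      next
        case False
        hence "\<nexists>u. d = c + 2 * u" by auto
        thus ?thesis using supp[of d] False unfolding c by auto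
      qed
    qed
    fix S assume "?P = monom 1 c * pcompose S [:0, 0, 1:]"
    hence "coeff ?P (c + 2 * u) = coeff S u" for u by (simp only: c) simp
    thus "S = R" by (intro poly_eqI) (simp add: R)
  qed
  thus ?thesis by (simp add: R)
qed

lemma F2_hookprod:
  assumes "is_partition a" "length a \<le> L1" "is_partition b" "length b \<le> L2"
  shows "real (F2 a b) * (hookprod (\<lambda>_. True) (betas L1 a) * hookprod (\<lambda>_. True) (betas L2 b)) =
    fact (psize a + psize b)"
proof -
  have "real (F2 a b) * (hookprod (\<lambda>_. True) (betas L1 a) * hookprod (\<lambda>_. True) (betas L2 b)) =
    real ((psize a + psize b) choose psize a) * (fact (psize a) * fact (psize b))"
    unfolding fact_eq_Fskew_hookprod[OF assms(1,2), symmetric] fact_eq_Fskew_hookprod[OF assms(3,4), symmetric]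
    by (simp add: F2_def F2skew_def psize_def mult_ac)
  also have "\<dots> = fact (psize a + psize b)"
    by (simp add: binomial_fact)
  finally show ?thesis .
qed

lemma hookprod_Phi:
  assumes "is_partition a" "length a \<le> L1" "is_partition b" "length b \<le> L2" "L2 = L1 + k"
  shows "hookprod (\<lambda>_. True) (weave (betas L1 a) (betas L2 b)) = real (Hodd (Phi a b (int k))) *
    (2 ^ (psize a + psize b) * (hookprod (\<lambda>_. True) (betas L1 a) * hookprod (\<lambda>_. True) (betas L2 b)))"
proof -
  have "int L2 = int L1 + int k" using assms(5) by simp
  note P = betas_Phi[OF assms(1-4) this]
  show ?thesis
    unfolding hookprod_parity[of "weave _ _"] Hodd_hookprod[OF P(1,2)] P(3)
    by (simp add: hookprod_even_weave sum_card_gaps[OF assms(1,2)] sum_card_gaps[OF assms(3,4)])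
qed

text \<open>Here \<open>K\<close> is the skew chain number, \<open>F\<close>, \<open>X\<close>,
  \<open>H\<close>, \<open>smn\<close> are the chain number, quotient hook product, odd hook product
  and sign of \<open>(mu, nu)\<close>, and \<open>f\<close>, \<open>x\<close>, \<open>h\<close>,
  \<open>sab\<close> those of the smaller pair. The surplus \<open>2 ^ j\<close> from even hooks
  cancels the denominator, and \<open>X / x\<close> expressed through \<open>F\<close> and
  \<open>f\<close> completes the binomial coefficient.\<close>

lemma rescaled_term_eq:
  fixes K h H f F x X s sab smn :: real
  assumes F: "F * X = fact (u + j)" and f: "f * x = fact u"
    and pos: "0 < X" "0 < x" "0 < H" "0 < h"
    and s: "smn * sab = s" "smn * smn = 1"
  shows "(- 1 / 2) ^ j / fact j * K * (sab / (h * (2 ^ u * x))) / (smn / (H * (2 ^ (u + j) * X))) =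
    (- 1) ^ j * real ((u + j) choose j) * (s * (f * K / F) * (H / h))"
proof -
  have "smn \<noteq> 0" using s(2) by auto
  hence smn: "smn \<noteq> 0" "1 / smn = smn" using s(2) by (simp_all add: divide_eq_eq)
  have binom: "real ((u + j) choose j) = fact (u + j) / (fact j * fact u)"
    by (simp add: binomial_fact)
  have nz: "F \<noteq> 0" "f \<noteq> 0" using F f by auto
  have Xx: "X = fact (u + j) / F" "x = fact u / f" using F f nz by (simp_all add: field_simps)
  have pw: "(- 1 / 2) ^ j = (- 1 :: real) ^ j / 2 ^ j" by (rule power_divide)
  have "(- 1 / 2) ^ j / fact j * K * (sab / (h * (2 ^ u * x))) / (smn / (H * (2 ^ (u + j) * X))) =
    (- 1) ^ j / fact j * K * (sab * (1 / smn)) * (H * X) / (h * x)"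
    unfolding pw using pos smn(1) by (simp add: power_add field_simps)
  also have "\<dots> = (- 1) ^ j / fact j * K * s * (H * X) / (h * x)"
    unfolding smn(2) using s(1) by (simp add: mult.commute)
  also have "\<dots> = (- 1) ^ j * real ((u + j) choose j) * (s * (f * K / F) * (H / h))"
    unfolding binom Xx using nz pos by (simp add: field_simps)
  finally show ?thesis .
qed

theorem theorem4p4:
  fixes mu nu :: "nat list" and k j :: nat
  assumes "is_partition mu" and "is_partition nu"
    and "j \<le> psize mu + psize nu"
  shows "coeff (Rpoly (Phi mu nu (int k)) (\<Sum>i=1..k. i)) (psize mu + psize nu - j) =
    (-1) ^ j * real ((psize mu + psize nu) choose j) *
    (\<Sum>(a, b) \<in> pairs_below j mu nu.
       (-1) ^ ht2 (Phi mu nu (int k)) (Phi a b (int k)) *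
       (real (F2 a b) * real (F2skew mu nu a b) / real (F2 mu nu)) *
       (real (Hodd (Phi mu nu (int k))) / real (Hodd (Phi a b (int k)))))"
proof -
  \<comment> \<open>The difference of the paddings must be \<open>k\<close>; this \<open>L1\<close>
    is large enough that \<open>L2\<close> also accommodates \<open>nu\<close>.\<close>
  define L1 L2 where "L1 = length mu + length nu" and "L2 = L1 + k"
  have len: "length mu \<le> L1" "length nu \<le> L2" by (simp_all add: L1_def L2_def)
  have k: "int L2 = int L1 + int k" by (simp add: L2_def)
  note mu = assms(1) len(1) and nu = assms(2) len(2)
  let ?L = "L1 + L2" and ?N = "psize mu + psize nu" and ?c = "\<Sum>i=1..k. i"
  let ?lam = "Phi mu nu (int k)" and ?D = "\<lambda>a b. jtdet rfact (L1 + L2) (gam L1 L2 a b)"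
  let ?HT = "hookprod (\<lambda>_. True)"
  note P = betas_Phi[OF mu nu k]
  have HeP: "HeP ?lam = smult (1 / ?D mu nu) (jtdet nHe ?L (gam L1 L2 mu nu))"
    by (rule HeP_rows[OF P(1,2) gam_inj[OF mu(1) nu(1)]]) (simp only: gam_image P(3))
  have coeff: "coeff (HeP ?lam) d =
      (\<Sum>(a, b)\<in>below mu nu. if d = ?c + 2 * (psize a + psize b)
        then (- 1 / 2) ^ (?N - (psize a + psize b)) / fact (?N - (psize a + psize b))
          * real (F2skew mu nu a b) * ?D a b / ?D mu nu
        else 0)" for d
    unfolding HeP coeff_smult coeff_jtdet_gam[OF mu nu L2_def] sum_distrib_left
    by (intro sum.cong) auto
  have supp: "\<exists>u. d = ?c + 2 * u" if "coeff (HeP ?lam) d \<noteq> 0" for d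
  proof (rule ccontr)
    assume "\<nexists>u. d = ?c + 2 * u"
    hence "d \<noteq> ?c + 2 * (psize a + psize b)" for a b by blast
    hence "coeff (HeP ?lam) d = 0" unfolding coeff by (simp only: if_False split_def sum.neutral_const)
    with that show False by simp
  qed
  have pairs: "pairs_below j mu nu = {ab \<in> below mu nu. psize (fst ab) + psize (snd ab) = ?N - j}"
    unfolding pairs_below_def below_def using assms(3) by auto
  have "coeff (Rpoly ?lam ?c) (?N - j) = coeff (HeP ?lam) (?c + 2 * (?N - j))"
    by (rule coeff_Rpoly[OF supp])
  also have "\<dots> = (\<Sum>ab\<in>below mu nu. if psize (fst ab) + psize (snd ab) = ?N - j
        then (- 1 / 2) ^ j / fact j * real (F2skew mu nu (fst ab) (snd ab)) * ?D (fst ab) (snd ab) / ?D mu nu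
        else 0)"
    unfolding coeff using assms(3) by (intro sum.cong refl) auto
  also have "\<dots> = (\<Sum>ab\<in>pairs_below j mu nu.
      (- 1 / 2) ^ j / fact j * real (F2skew mu nu (fst ab) (snd ab)) * ?D (fst ab) (snd ab) / ?D mu nu)"
    unfolding pairs by (rule sum.inter_filter[symmetric]) (rule finite_below[OF mu(1) nu(1)])
  also have "\<dots> = (\<Sum>ab\<in>pairs_below j mu nu. (- 1) ^ j * real (?N choose j) *
      ((- 1) ^ ht2 ?lam (Phi (fst ab) (snd ab) (int k)) *
       (real (F2 (fst ab) (snd ab)) * real (F2skew mu nu (fst ab) (snd ab)) / real (F2 mu nu)) *
       (real (Hodd ?lam) / real (Hodd (Phi (fst ab) (snd ab) (int k))))))"
  proof (intro sum.cong refl)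
    fix ab assume ab_mem: "ab \<in> pairs_below j mu nu"
    obtain a b where ab_eq: "ab = (a, b)" by fastforce
    have below: "(a, b) \<in> below mu nu" and size: "?N = (psize a + psize b) + j"
      using ab_mem assms(3) unfolding pairs ab_eq by auto
    have sub: "is_partition a" "is_partition b" "cells a \<subseteq> cells mu" "cells b \<subseteq> cells nu"
      using below by (simp_all add: below_def)
    have a: "is_partition a" "length a \<le> L1" and b: "is_partition b" "length b \<le> L2"
      using sub length_le_of_subset[OF sub(1) mu(1) sub(3)] length_le_of_subset[OF sub(2) nu(1) sub(4)] len
      by simp_all
    \<comment> \<open>Each leading coefficient splits into its sign, the odd hooks and the even
      hooks; the last are expressed by the quotient.\<close>
    have D: "?D p q = vsign ?L (gam L1 L2 p q) / (real (Hodd (Phi p q (int k))) *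
        (2 ^ (psize p + psize q) * (?HT (betas L1 p) * ?HT (betas L2 q))))"
      if "is_partition p" "length p \<le> L1" "is_partition q" "length q \<le> L2" for p q
    proof -
      have "0 \<le> gam L1 L2 p q i" if "i < ?L" for i
        using that beta_nonneg[of i L1 p] beta_nonneg[of "i - L1" L2 q] by (auto simp: gam_def)
      hence "?D p q = vsign ?L (gam L1 L2 p q) / ?HT (gam L1 L2 p q ` {..<?L})"
        by (rule jtdet_rfact_hookprod[OF gam_inj[OF that(1,3)]])
      thus ?thesis by (simp only: gam_image hookprod_Phi[OF that L2_def])
    qed
    have Hpos: "0 < real (Hodd (Phi p q (int k)))"
      if "is_partition p" "length p \<le> L1" "is_partition q" "length q \<le> L2" for p q
      using Hodd_hookprod[OF betas_Phi(1,2)[OF that k]] hookprod_pos by simp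
    have F: "real (F2 mu nu) * (?HT (betas L1 mu) * ?HT (betas L2 nu)) = fact (psize a + psize b + j)"
      unfolding F2_hookprod[OF mu nu] size ..
    have sgn: "vsign ?L (gam L1 L2 mu nu) * vsign ?L (gam L1 L2 a b) = (- 1) ^ ht2 ?lam (Phi a b (int k))"
      unfolding ht2_sign[OF mu nu below L2_def] by (rule vsign_gam[OF mu(1) nu(1) a(1) b(1)])
    have "(- 1 / 2) ^ j / fact j * real (F2skew mu nu a b) * ?D a b / ?D mu nu =
       (- 1) ^ j * real (?N choose j) * ((- 1) ^ ht2 ?lam (Phi a b (int k)) *
       (real (F2 a b) * real (F2skew mu nu a b) / real (F2 mu nu)) *
       (real (Hodd ?lam) / real (Hodd (Phi a b (int k)))))"
      unfolding D[OF a b] D[OF mu nu] size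
      by (rule rescaled_term_eq[OF F F2_hookprod[OF a b] _ _ Hpos[OF mu nu] Hpos[OF a b] sgn
            vsign_square[OF gam_inj[OF mu(1) nu(1)]]])
         (simp_all add: hookprod_pos)
    thus "(- 1 / 2) ^ j / fact j * real (F2skew mu nu (fst ab) (snd ab)) * ?D (fst ab) (snd ab) / ?D mu nu =
       (- 1) ^ j * real (?N choose j) * ((- 1) ^ ht2 ?lam (Phi (fst ab) (snd ab) (int k)) *
       (real (F2 (fst ab) (snd ab)) * real (F2skew mu nu (fst ab) (snd ab)) / real (F2 mu nu)) *
       (real (Hodd ?lam) / real (Hodd (Phi (fst ab) (snd ab) (int k)))))"
      unfolding ab_eq fst_conv snd_conv .
  qed
  finally show ?thesis by (simp only: sum_distrib_left case_prod_unfold)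
qed

end
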